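(* Let $k,t$ be integers with $0<t\leq k$, and let $w$ be a $t$-pure, cyclically reduced word in $\{x_0,\ldots,x_k\}$. Let $n\geq 2k+2t$ be an integer. Then for each $i=0,\ldots,n-1$ the one-relator group $\langle x_i,\ldots,x_{i+k}\mid w\theta^i\rangle$ (subscripts mod $n$) embeds in the cyclically presented group $G_n(w)$. In particular, $G_n(w)$ is infinite.
   Context: A word involves a generator $x_j$ if $x_j$ or $x_j^{-1}$ occurs in it. Let $\langle Y\mid r\rangle$ be a one-relator group with $r$ cyclically reduced. A subset $Y_1\subseteq Y$ is a Magnus subset if it omits a generator which appears in $r$; the subgroup $\langle Y_1\rangle$ is then called a Magnus subgroup and, by the Freiheitssatz, is free on $Y_1$. For two Magnus subgroups $M_1=\langle Y_1\rangle$, $M_2=\langle Y_2\rangle$ it is known (Collins) that $M_1\cap M_2$ is either the free group $F(Y_1\cap Y_2)$ on $Y_1\cap Y_2$, or the free product of $F(Y_1\cap Y_2)$ with an infinite cyclic group; in the latter case $M_1$ and $M_2$ are said to have exceptional intersection. Thus not having exceptional intersection means $M_1\cap M_2=\langle Y_1\cap Y_2\rangle$. Definition of $t$-pure: let $0<t\leq k$. A cyclically reduced word $w$ in the alphabet $\{x_0,\ldots,x_k\}$ is $t$-pure if: (1) $w$ involves $x_0$ and $x_k$; (2) the Magnus subgroups $M_0=\langle x_1,\ldots,x_k\rangle$ and $M_k=\langle x_0,\ldots,x_{k-1}\rangle$ of $H=\langle x_0,\ldots,x_k\mid w\rangle$ do not have exceptional intersection; (3) for each $i=1,\ldots,k-t$,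 at least one of the letters $x_i,\ldots,x_{i+t-1}$ is involved in $w$, so that the subset $X_{i,i+t-1}=\{x_0,\ldots,x_{i-1},x_{i+t},\ldots,x_k\}$ freely generates a Magnus subgroup $M_{i,i+t-1}$ of $H$; and (4) for each $i=1,\ldots,k-t$, the Magnus subgroup $M_{i,i+t-1}$ does not have exceptional intersection with either $M_0$ or $M_k$. (If $t=k$, conditions (3) and (4) are vacuous.) For $n>k$, let $F_n$ be the free group on $x_0,\ldots,x_{n-1}$ and $\theta$ the automorphism of $F_n$ with $x_i\theta=x_{i+1}$ (subscripts mod $n$), so $w\theta^i=w(x_i,\ldots,x_{i+k})$. Then $G_n(w)=F_n/N$, where $N$ is the normal closure of $\{w,w\theta,\ldots,w\theta^{n-1}\}$. *)

theory Defs
  imports "HOL-Algebra.Generated_Groups"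
begin

section \<open>Words and free groups\<close>

text \<open>The letter \<open>(x, True)\<close> stands for the generator \<open>x\<close> and \<open>(x, False)\<close> for its inverse.\<close>

type_synonym 'a letter = "'a \<times> bool"
type_synonym 'a word = "'a letter list"

definition inv_letter :: "'a letter \<Rightarrow> 'a letter" where
  "inv_letter a = (fst a, \<not> snd a)"

definition words_over :: "'a set \<Rightarrow> 'a word set" where
  "words_over X = {u. fst ` set u \<subseteq> X}"

definition involves :: "'a word \<Rightarrow> 'a \<Rightarrow> bool" where
  "involves u x \<longleftrightarrow> (x, True) \<in> set u \<or> (x, False) \<in> set u"

definition reduced :: "'a word \<Rightarrow> bool" where
  "reduced u \<longleftrightarrow> successively (\<lambda>a b. b \<noteq> inv_letter a) u"

definition cyclically_reduced :: "'a word \<Rightarrow> bool" where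
  "cyclically_reduced u \<longleftrightarrow> reduced u \<and> (u \<noteq> [] \<longrightarrow> hd u \<noteq> inv_letter (last u))"

fun red_cons :: "'a letter \<Rightarrow> 'a word \<Rightarrow> 'a word" where
  "red_cons a [] = [a]"
| "red_cons a (b # u) = (if b = inv_letter a then u else a # b # u)"

definition reduce :: "'a word \<Rightarrow> 'a word" where
  "reduce u = foldr red_cons u []"

text \<open>The free group on \<open>X\<close>, realised on the reduced words over \<open>X\<close>.\<close>

definition free_group :: "'a set \<Rightarrow> 'a word monoid" where
  "free_group X = \<lparr>carrier = {u \<in> words_over X. reduced u},
                   monoid.mult = (\<lambda>u v. reduce (u @ v)),
                   one = []\<rparr>"

definition inv_word :: "'a word \<Rightarrow> 'a word" where
  "inv_word u = rev (map inv_letter u)"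

lemma inv_letter_inv_letter [simp]: "inv_letter (inv_letter a) = a"
  by (simp add: inv_letter_def)

lemma fst_inv_letter [simp]: "fst (inv_letter a) = fst a"
  by (simp add: inv_letter_def)

lemma inv_letter_eq_iff [simp]: "inv_letter a = inv_letter b \<longleftrightarrow> a = b"
  by (metis inv_letter_inv_letter)

lemma inv_letter_neq [simp]: "inv_letter a \<noteq> a" "a \<noteq> inv_letter a"
  by (auto simp: inv_letter_def prod_eq_iff)

lemma reduced_Nil [simp]: "reduced []"
  by (simp add: reduced_def)

lemma reduced_Cons: "reduced (a # u) \<longleftrightarrow> reduced u \<and> (u \<noteq> [] \<longrightarrow> hd u \<noteq> inv_letter a)"
  by (cases u) (auto simp: reduced_def)

lemma reduced_red_cons: "reduced u \<Longrightarrow> reduced (red_cons a u)"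
  by (cases u) (auto simp: reduced_Cons)

lemma reduced_foldr: "reduced v \<Longrightarrow> reduced (foldr red_cons u v)"
  by (induction u) (auto intro: reduced_red_cons)

lemma reduced_reduce [simp]: "reduced (reduce u)"
  by (simp add: reduce_def reduced_foldr)

lemma red_cons_cancel: "reduced u \<Longrightarrow> red_cons a (red_cons (inv_letter a) u) = u"
  by (cases u rule: remdups_adj.cases) (auto simp: reduced_Cons)

lemma reduce_reduced: "reduced u \<Longrightarrow> reduce u = u"
proof (induction u)
  case (Cons a u)
  then show ?case by (cases u) (auto simp: reduced_Cons reduce_def)
qed (simp add: reduce_def)

lemma foldr_red_cons_red_cons:
  assumes "reduced w"
  shows "foldr red_cons (red_cons a u) w = red_cons a (foldr red_cons u w)"
proof (cases u)
  case (Cons b v)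
  then show ?thesis
    using red_cons_cancel[OF reduced_foldr[OF assms, of v], of a] by auto
qed simp

lemma foldr_red_cons_reduce:
  "reduced w \<Longrightarrow> foldr red_cons (reduce u) w = foldr red_cons u w"
  by (induction u) (auto simp: reduce_def foldr_red_cons_red_cons)

lemma reduce_append: "reduce (u @ v) = foldr red_cons u (reduce v)"
  by (simp add: reduce_def)

lemma reduce_append_left: "reduce (reduce u @ v) = reduce (u @ v)"
  by (simp add: reduce_append foldr_red_cons_reduce)

lemma reduce_append_right: "reduce (u @ reduce v) = reduce (u @ v)"
  by (simp add: reduce_append reduce_reduced)

lemma reduce_inv_word_append: "reduce (inv_word u @ u) = []"
proof (induction u)
  case (Cons a u)
  have "reduce (inv_word (a # u) @ a # u)
      = foldr red_cons (inv_word u) (red_cons (inv_letter a) (red_cons a (reduce u)))"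
    by (simp add: inv_word_def reduce_def)
  also have "red_cons (inv_letter a) (red_cons a (reduce u)) = reduce u"
    using red_cons_cancel[of "reduce u" "inv_letter a"] by simp
  finally show ?case
    using Cons.IH by (simp add: reduce_append)
qed (simp add: inv_word_def reduce_def)

lemma fst_set_red_cons: "fst ` set (red_cons a u) \<subseteq> insert (fst a) (fst ` set u)"
  by (cases u) auto

lemma fst_set_reduce: "fst ` set (reduce u) \<subseteq> fst ` set u"
proof (induction u)
  case (Cons a u)
  have "reduce (a # u) = red_cons a (reduce u)" by (simp add: reduce_def)
  then have "fst ` set (reduce (a # u)) \<subseteq> insert (fst a) (fst ` set (reduce u))"
    using fst_set_red_cons[of a "reduce u"] by simp
  also have "\<dots> \<subseteq> insert (fst a) (fst ` set u)"
    using Cons.IH by (rule insert_mono)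
  finally show ?case by simp
qed (simp add: reduce_def)

lemma reduce_words_over: "u \<in> words_over X \<Longrightarrow> reduce u \<in> words_over X"
  using fst_set_reduce[of u] by (auto simp: words_over_def)

lemma inv_word_words_over: "u \<in> words_over X \<Longrightarrow> inv_word u \<in> words_over X"
  by (auto simp: words_over_def inv_word_def image_subset_iff)

lemma group_free_group: "group (free_group X)"
proof (rule groupI)
  fix u assume "u \<in> carrier (free_group X)"
  then show "\<exists>v\<in>carrier (free_group X). v \<otimes>\<^bsub>free_group X\<^esub> u = \<one>\<^bsub>free_group X\<^esub>"
    by (intro bexI[of _ "reduce (inv_word u)"])
       (auto simp: free_group_def reduce_append_left reduce_inv_word_append
             intro!: reduce_words_over inv_word_words_over)
next
  fix u v assume "u \<in> carrier (free_group X)" "v \<in> carrier (free_group X)"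
  then have "u @ v \<in> words_over X" by (auto simp: free_group_def words_over_def)
  then show "u \<otimes>\<^bsub>free_group X\<^esub> v \<in> carrier (free_group X)"
    by (simp add: free_group_def reduce_words_over)
qed (auto simp: free_group_def words_over_def reduce_append_left reduce_append_right
        reduce_reduced)

section \<open>Presentations\<close>

definition normal_closure :: "('a, 'b) monoid_scheme \<Rightarrow> 'a set \<Rightarrow> 'a set" where
  "normal_closure G S = \<Inter> {N. N \<lhd> G \<and> S \<subseteq> N}"

text \<open>The group presented by generators \<open>X\<close> and relators \<open>R\<close>, where the relators are
  given as reduced words over \<open>X\<close>, that is, as elements of the free group.\<close>

definition presented_group :: "'a set \<Rightarrow> 'a word set \<Rightarrow> 'a word set monoid" where
  "presented_group X R = free_group X Mod normal_closure (free_group X) R"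

definition generator :: "'a set \<Rightarrow> 'a word set \<Rightarrow> 'a \<Rightarrow> 'a word set" where
  "generator X R x = normal_closure (free_group X) R #>\<^bsub>free_group X\<^esub> [(x, True)]"

lemma (in group) normal_closure_normal:
  assumes "S \<subseteq> carrier G"
  shows "normal_closure G S \<lhd> G"
proof -
  have ne: "carrier G \<in> {N. N \<lhd> G \<and> S \<subseteq> N}"
    using assms normal_inv_iff subgroup_self by auto
  have sub: "subgroup (normal_closure G S) G"
    unfolding normal_closure_def
    using ne by (intro subgroups_Inter) (auto simp: normal_inv_iff)
  moreover have "x \<otimes> h \<otimes> inv x \<in> normal_closure G S"
    if "x \<in> carrier G" "h \<in> normal_closure G S" for x h
    using that unfolding normal_closure_def by (auto simp: normal_inv_iff)
  ultimately show ?thesis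
    by (simp add: normal_inv_iff)
qed

lemma group_presented_group:
  "R \<subseteq> carrier (free_group X) \<Longrightarrow> group (presented_group X R)"
  unfolding presented_group_def
  by (intro normal.factorgroup_is_group group.normal_closure_normal group_free_group)

section \<open>Magnus subgroups\<close>

text \<open>In the one-relator group \<open>\<langle>X | r\<rangle>\<close>, the subset \<open>Y\<close> of \<open>X\<close> is a Magnus subset if it
  omits a generator that appears in \<open>r\<close>.\<close>

definition magnus_subset :: "'a set \<Rightarrow> 'a word \<Rightarrow> 'a set \<Rightarrow> bool" where
  "magnus_subset X r Y \<longleftrightarrow> Y \<subseteq> X \<and> (\<exists>x \<in> X - Y. involves r x)"

definition magnus_subgroup :: "'a set \<Rightarrow> 'a word \<Rightarrow> 'a set \<Rightarrow> 'a word set set" where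
  "magnus_subgroup X r Y = generate (presented_group X {r}) (generator X {r} ` Y)"

text \<open>By Collins's theorem, the intersection of two Magnus subgroups \<open>\<langle>Y\<^sub>1\<rangle>\<close> and \<open>\<langle>Y\<^sub>2\<rangle>\<close> is
  either \<open>\<langle>Y\<^sub>1 \<inter> Y\<^sub>2\<rangle>\<close> or the free product of a copy of the free group on \<open>Y\<^sub>1 \<inter> Y\<^sub>2\<close> with an
  infinite cyclic group. The intersection is exceptional when the first alternative fails.\<close>

definition exceptional_intersection :: "'a set \<Rightarrow> 'a word \<Rightarrow> 'a set \<Rightarrow> 'a set \<Rightarrow> bool" where
  "exceptional_intersection X r Y1 Y2 \<longleftrightarrow>
     magnus_subgroup X r Y1 \<inter> magnus_subgroup X r Y2 \<noteq> magnus_subgroup X r (Y1 \<inter> Y2)"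

section \<open>\<open>t\<close>-pure words\<close>

text \<open>The letter \<open>x\<^sub>j\<close> is encoded by the natural number \<open>j\<close>. In the last clause, the set
  \<open>{..<i} \<union> {i + t..k}\<close> is \<open>X\<^bsub>i,i+t-1\<^esub>\<close>; by the clause before it is a Magnus subset.\<close>

definition t_pure :: "nat \<Rightarrow> nat \<Rightarrow> nat word \<Rightarrow> bool" where
  "t_pure k t w \<longleftrightarrow>
     involves w 0 \<and> involves w k \<and>
     \<not> exceptional_intersection {0..k} w {1..k} {0..<k} \<and>
     (\<forall>i \<in> {1..k - t}. \<exists>j \<in> {i..i + t - 1}. involves w j) \<and>
     (\<forall>i \<in> {1..k - t}.
        \<not> exceptional_intersection {0..k} w ({..<i} \<union> {i + t..k}) {1..k} \<and>
        \<not> exceptional_intersection {0..k} w ({..<i} \<union> {i + t..k}) {0..<k})"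

lemma t_pure_magnus_subsets:
  assumes "t_pure k t w" "0 < t" "t \<le> k"
  shows "magnus_subset {0..k} w {1..k}" "magnus_subset {0..k} w {0..<k}"
    and "i \<in> {1..k - t} \<Longrightarrow> magnus_subset {0..k} w ({..<i} \<union> {i + t..k})"
proof -
  show "magnus_subset {0..k} w {1..k}" "magnus_subset {0..k} w {0..<k}"
    using assms by (auto simp: t_pure_def magnus_subset_def)
  assume i: "i \<in> {1..k - t}"
  with assms obtain j where "j \<in> {i..i + t - 1}" "involves w j"
    unfolding t_pure_def by blast
  with i assms show "magnus_subset {0..k} w ({..<i} \<union> {i + t..k})"
    unfolding magnus_subset_def by (auto intro!: bexI[of _ j])
qed

section \<open>Cyclically presented groups\<close>

text \<open>The automorphism \<open>\<theta>\<close> of the free group on \<open>x\<^sub>0, \<dots>, x\<^bsub>n-1\<^esub>\<close>. It permutes the letters with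
  index below \<open>n\<close>, so it sends reduced words in them to reduced words.\<close>

definition theta :: "nat \<Rightarrow> nat word \<Rightarrow> nat word" where
  "theta n = map (\<lambda>(j, e). ((j + 1) mod n, e))"

definition cyclic_relators :: "nat \<Rightarrow> nat word \<Rightarrow> nat word set" where
  "cyclic_relators n w = {(theta n ^^ i) w | i. i < n}"

definition cyclically_presented_group :: "nat \<Rightarrow> nat word \<Rightarrow> nat word set monoid" where
  "cyclically_presented_group n w = presented_group {0..<n} (cyclic_relators n w)"

definition cyclic_window :: "nat \<Rightarrow> nat \<Rightarrow> nat \<Rightarrow> nat set" where
  "cyclic_window n k i = {(i + j) mod n | j. j \<le> k}"

lemma theta_in_free_group:
  assumes "u \<in> carrier (free_group {0..<n})"
  shows "theta n u \<in> carrier (free_group {0..<n})"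
proof -
  have inj: "(a + 1) mod n = (b + 1) mod n \<Longrightarrow> a = b" if "a < n" "b < n" for a b :: nat
    using that by (auto simp: mod_Suc split: if_splits)
  show ?thesis
    using assms
  proof (induction u)
    case (Cons a u)
    then have a: "fst a < n" and u: "u \<in> carrier (free_group {0..<n})"
      by (auto simp: free_group_def words_over_def reduced_Cons)
    have "hd (theta n u) \<noteq> inv_letter ((fst a + 1) mod n, snd a)" if "u \<noteq> []"
    proof -
      from that obtain b v where b: "u = b # v" by (cases u) auto
      with u have "fst b < n" by (auto simp: free_group_def words_over_def)
      with Cons.prems b a show ?thesis
        using inj[of "fst b" "fst a"]
        by (auto simp: free_group_def reduced_Cons theta_def inv_letter_def split_beta prod_eq_iff)
    qed
    with Cons.IH[OF u] a show ?case
      by (auto simp: free_group_def words_over_def reduced_Cons theta_def split_beta)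
  qed (simp add: theta_def free_group_def words_over_def)
qed

lemma group_cyclically_presented_group:
  assumes "w \<in> words_over {0..k}" "reduced w" "k < n"
  shows "group (cyclically_presented_group n w)"
proof -
  have "w \<in> carrier (free_group {0..<n})"
    using assms by (force simp: free_group_def words_over_def)
  then have "(theta n ^^ i) w \<in> carrier (free_group {0..<n})" for i
    by (induction i) (auto intro: theta_in_free_group)
  then show ?thesis
    unfolding cyclically_presented_group_def cyclic_relators_def
    by (intro group_presented_group) auto
qed

end

(*
  Cut the cycle of relators of G_n(w) into two linear chains of at least k + t consecutive
  translates of w each. By the Freiheitssatz a linear chain is an iterated amalgamated product of
  one-relator groups over free groups of rank k, so each one-relator group embeds in it. If t
  consecutive generators or more separate the first k from the last k generators of the chain,
  then t-purity says that in every factor the remaining generators meet both amalgamated subgroups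
  only in the obvious way; hence these 2k generators are a free basis of the subgroup they generate.
  So G_n(w) is the amalgamated product of the two chains over a free group of rank 2k.

  Amalgamated products are handled through van der Waerden's permutation action on normal forms,
  and the Freiheitssatz by Magnus's induction on the length of the relator. Groups are treated as
  words modulo the congruence generated by the relators.
*)
theory Submission
  imports Defs "HOL-Library.Nat_Bijection"
begin

section \<open>The congruence on words defined by a set of relators\<close>

text \<open>The bound 2k + 2t gives each of the two chains at least k + t relators. A chain of m
  consecutive translates has the generators 0, ..., m + k - 1; keeping its first and last k drops m
  - k \<ge> t consecutive ones. A translate of w then loses its letter x_0, its letter x_k, or a
  block of at least t inner letters, and these are the cases that t-purity provides for. An equation
  between subgroups generated by letters is hard to restrict to fewer letters. Once the letters are
  a free basis, it becomes a statement about free reduction of words, which passes to subsets at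
  once. So the Freiheitssatz serves twice: to form the amalgamated products, and to bring the
  conditions of t-purity into a form that the induction along a chain can use. Words range over all
  letters of a type, so one congruence serves all alphabets at once; the price is that derivations
  may leave the alphabet of a group.\<close>

inductive eqv :: "'a word set \<Rightarrow> 'a word \<Rightarrow> 'a word \<Rightarrow> bool" for R where
  refl [simp, intro]: "eqv R u u"
| sym: "eqv R u v \<Longrightarrow> eqv R v u"
| trans: "eqv R u v \<Longrightarrow> eqv R v w \<Longrightarrow> eqv R u w"
| cancel: "eqv R (u @ a # inv_letter a # v) (u @ v)"
| relator: "r \<in> R \<Longrightarrow> eqv R (u @ r @ v) (u @ v)"

lemmas eqv_sym = eqv.sym and eqv_trans [trans] = eqv.trans

lemma eqv_context: "eqv R u v \<Longrightarrow> eqv R (a @ u @ b) (a @ v @ b)"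
proof (induction rule: eqv.induct)
  case (cancel u x v)
  then show ?case using eqv.cancel[of R "a @ u" x "v @ b"] by simp
next
  case (relator r u v)
  then show ?case using eqv.relator[of r R "a @ u" "v @ b"] by simp
qed (auto intro: eqv.sym eqv.trans)

lemma eqv_append: "eqv R u u' \<Longrightarrow> eqv R v v' \<Longrightarrow> eqv R (u @ v) (u' @ v')"
  using eqv_context[of R u u' "[]" v] eqv_context[of R v v' u' "[]"] by (auto intro: eqv.trans)

lemma eqv_appendL: "eqv R v v' \<Longrightarrow> eqv R (u @ v) (u @ v')"
  and eqv_appendR: "eqv R u u' \<Longrightarrow> eqv R (u @ v) (u' @ v)"
  by (auto intro: eqv_append)

lemma eqv_mono: "eqv R u v \<Longrightarrow> R \<subseteq> R' \<Longrightarrow> eqv R' u v"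
  by (induction rule: eqv.induct) (auto intro: eqv.intros)

lemma eqv_relator_Nil: "r \<in> R \<Longrightarrow> eqv R r []"
  using eqv.relator[of r R "[]" "[]"] by simp

lemma inv_word_Nil [simp]: "inv_word [] = []"
  by (simp add: inv_word_def)

lemma inv_word_append [simp]: "inv_word (u @ v) = inv_word v @ inv_word u"
  by (simp add: inv_word_def)

lemma inv_word_inv_word [simp]: "inv_word (inv_word u) = u"
  by (induction u) (simp_all add: inv_word_def rev_map)

lemma eqv_inv_word_left [simp]: "eqv R (inv_word u @ u) []"
proof (induction u)
  case (Cons a u)
  show ?case
    using eqv.cancel[of R "inv_word u" "inv_letter a" u] Cons eqv.trans
    by (fastforce simp: inv_word_def)
qed simp

lemma eqv_inv_word_right [simp]: "eqv R (u @ inv_word u) []"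
  using eqv_inv_word_left[of R "inv_word u"] by simp

lemma eqv_iff_append_inv_word: "eqv R u v \<longleftrightarrow> eqv R (u @ inv_word v) []"
proof
  assume "eqv R u v"
  then show "eqv R (u @ inv_word v) []"
    by (meson eqv_appendR eqv_inv_word_right eqv_trans)
next
  assume "eqv R (u @ inv_word v) []"
  then have "eqv R (u @ inv_word v @ v) v"
    using eqv_appendR[of R "u @ inv_word v" "[]" v] by simp
  moreover have "eqv R (u @ inv_word v @ v) u"
    using eqv_appendL[OF eqv_inv_word_left, of R u v] by simp
  ultimately show "eqv R u v" by (meson eqv_sym eqv_trans)
qed

lemma eqv_cancel_right: "eqv R (u @ w) (v @ w) \<longleftrightarrow> eqv R u v"
proof
  assume "eqv R (u @ w) (v @ w)"
  then have "eqv R (u @ w @ inv_word w) (v @ w @ inv_word w)"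
    using eqv_appendR by fastforce
  moreover have "eqv R (a @ w @ inv_word w) a" for a
    using eqv_appendL[OF eqv_inv_word_right, of R a w] by simp
  ultimately show "eqv R u v" by (meson eqv_sym eqv_trans)
qed (rule eqv_appendR)

lemma eqv_move_left: "eqv R u (c @ v) \<longleftrightarrow> eqv R (inv_word c @ u) v"
proof
  assume "eqv R u (c @ v)"
  then have "eqv R (inv_word c @ u) ((inv_word c @ c) @ v)"
    using eqv_appendL by fastforce
  then show "eqv R (inv_word c @ u) v"
    using eqv_appendR[OF eqv_inv_word_left, of R c v] eqv_trans by fastforce
next
  assume "eqv R (inv_word c @ u) v"
  then have "eqv R ((c @ inv_word c) @ u) (c @ v)"
    using eqv_appendL by fastforce
  then show "eqv R u (c @ v)"
    using eqv_appendR[OF eqv_inv_word_right, of R c u] eqv_trans eqv_sym by fastforce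
qed

text \<open>A letterwise substitution that respects inverses and kills the relators induces a
  homomorphism. It serves both for renaming letters and for deleting a generator.\<close>

lemma eqv_subst:
  assumes "eqv R u v"
    and inv: "\<And>a. eqv R' (f a @ f (inv_letter a)) []"
    and rel: "\<And>r. r \<in> R \<Longrightarrow> eqv R' (concat (map f r)) []"
  shows "eqv R' (concat (map f u)) (concat (map f v))"
  using assms(1)
proof (induction rule: eqv.induct)
  case (cancel u a v)
  then show ?case
    using eqv_context[OF inv[of a], of "concat (map f u)" "concat (map f v)"] by simp
next
  case (relator r u v)
  then show ?case
    using eqv_context[OF rel[of r], of "concat (map f u)" "concat (map f v)"] by simp
qed (auto intro: eqv.sym eqv.trans)

lemma eqv_rename:
  assumes "eqv R u v"
  shows "eqv (map (map_prod f id) ` R) (map (map_prod f id) u) (map (map_prod f id) v)"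
proof -
  have c: "concat (map (\<lambda>a. [map_prod f id a]) x) = map (map_prod f id) x" for x :: "'a word"
    by (induction x) auto
  have "eqv S [map_prod f id a, map_prod f id (inv_letter a)] []" for a :: "'a letter" and S
    using eqv.cancel[of S "[]" "map_prod f id a" "[]"]
    by (simp add: inv_letter_def map_prod_def split_beta)
  then show ?thesis
    using eqv_subst[OF assms, of "map (map_prod f id) ` R" "\<lambda>a. [map_prod f id a]"]
    by (auto simp: c intro: eqv_relator_Nil)
qed

text \<open>A derivation has finitely many steps. Magnus's rewriting produces one relator for every
  integer level, and this reduces them to a finite chain.\<close>

lemma eqv_finite: "eqv R u v \<Longrightarrow> \<exists>R0 \<subseteq> R. finite R0 \<and> eqv R0 u v"
proof (induction rule: eqv.induct)
  case (trans u v w)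
  then obtain R1 R2 where "R1 \<subseteq> R" "finite R1" "eqv R1 u v" "R2 \<subseteq> R" "finite R2" "eqv R2 v w"
    by blast
  then show ?case
    by (intro exI[of _ "R1 \<union> R2"]) (auto intro: eqv.trans eqv_mono)
next
  case (relator r u v)
  then show ?case
    by (intro exI[of _ "{r}"]) (auto intro: eqv.relator)
qed (auto intro: eqv.sym eqv.intros)

lemma eqv_red_cons: "eqv R (a # u) (red_cons a u)"
  using eqv.cancel[of R "[]" a] by (cases u) auto

lemma eqv_reduce: "eqv R u (reduce u)"
proof (induction u)
  case (Cons a u)
  have "eqv R (a # u) (a # reduce u)"
    using eqv_appendL[OF Cons, of "[a]"] by simp
  also have "eqv R (a # reduce u) (reduce (a # u))"
    using eqv_red_cons[of R a "reduce u"] by (simp add: reduce_def)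
  finally show ?case .
qed (simp add: reduce_def)

lemma reduce_cancel: "reduce (u @ a # inv_letter a # v) = reduce (u @ v)"
proof -
  have "reduce (a # inv_letter a # v) = reduce v"
    using red_cons_cancel[OF reduced_reduce[of v], of a] by (simp add: reduce_def)
  then show ?thesis by (simp add: reduce_append)
qed

lemma eqv_empty_iff: "eqv {} u v \<longleftrightarrow> reduce u = reduce v"
proof
  assume "eqv {} u v"
  then show "reduce u = reduce v"
    by (induction rule: eqv.induct) (auto simp: reduce_cancel)
next
  assume "reduce u = reduce v"
  then show "eqv {} u v"
    using eqv_reduce[of "{}" u] eqv_reduce[of "{}" v] by (metis eqv_sym eqv_trans)
qed

lemma eqv_empty_mono: "eqv {} u v \<Longrightarrow> eqv R u v"
  by (rule eqv_mono) auto

lemma words_over_Nil [simp, intro]: "[] \<in> words_over X"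
  and words_over_Cons [simp]: "a # u \<in> words_over X \<longleftrightarrow> fst a \<in> X \<and> u \<in> words_over X"
  and words_over_append [simp]: "u @ v \<in> words_over X \<longleftrightarrow> u \<in> words_over X \<and> v \<in> words_over X"
  by (auto simp: words_over_def)

lemma words_over_mono: "u \<in> words_over X \<Longrightarrow> X \<subseteq> Y \<Longrightarrow> u \<in> words_over Y"
  by (auto simp: words_over_def)

lemma words_over_Int: "u \<in> words_over (X \<inter> Y) \<longleftrightarrow> u \<in> words_over X \<and> u \<in> words_over Y"
  by (auto simp: words_over_def)

text \<open>Free reduction only deletes letters, so the common reduced form of \<open>u\<close> and
  \<open>v\<close> lies over both alphabets.\<close>

lemma eqv_empty_words_over_Int:
  assumes "eqv {} u v" "u \<in> words_over X" "v \<in> words_over Y"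
  obtains d where "d \<in> words_over (X \<inter> Y)" "eqv {} u d"
  using assms that[of "reduce u"] reduce_words_over[of u X] reduce_words_over[of v Y]
  by (auto simp: eqv_empty_iff words_over_Int reduce_reduced)

definition free_in :: "'a word set \<Rightarrow> 'a set \<Rightarrow> bool" where
  "free_in R Y \<longleftrightarrow> (\<forall>u \<in> words_over Y. eqv R u [] \<longrightarrow> eqv {} u [])"

lemma free_in_mono: "free_in R Y \<Longrightarrow> Y' \<subseteq> Y \<Longrightarrow> free_in R Y'"
  by (auto simp: free_in_def intro: words_over_mono)

lemma free_in_antimono: "free_in R Y \<Longrightarrow> R' \<subseteq> R \<Longrightarrow> free_in R' Y"
  by (auto simp: free_in_def intro: eqv_mono)

lemma free_in_eqv:
  assumes "free_in R Y" "u \<in> words_over Y" "v \<in> words_over Y" "eqv R u v"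
  shows "eqv {} u v"
  using assms eqv_iff_append_inv_word[of R u v] eqv_iff_append_inv_word[of "{}" u v]
  by (auto simp: free_in_def inv_word_words_over)

text \<open>If \<open>Y\<close> is free, this says that \<open>\<langle>Y\<rangle> \<inter> \<langle>C\<rangle> = \<langle>Y \<inter> C\<rangle>\<close> in the group with relators \<open>R\<close>.\<close>

definition meets_in :: "'a word set \<Rightarrow> 'a set \<Rightarrow> 'a set \<Rightarrow> bool" where
  "meets_in R Y C \<longleftrightarrow>
     (\<forall>u \<in> words_over Y. \<forall>c \<in> words_over C. eqv R u c \<longrightarrow> (\<exists>d \<in> words_over (Y \<inter> C). eqv {} u d))"

lemma meets_inD:
  assumes "meets_in R Y C" "u \<in> words_over Y" "c \<in> words_over C" "eqv R u c"
  obtains d where "d \<in> words_over (Y \<inter> C)" "eqv {} u d"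
  using assms unfolding meets_in_def by blast

text \<open>Comparing a trivial word over \<open>Y\<close> with the empty word over \<open>C\<close>
  moves it into \<open>Y \<inter> C\<close>, where the freeness of \<open>C\<close> applies.\<close>

lemma free_in_if_meets_in:
  assumes "meets_in R Y C" "free_in R C"
  shows "free_in R Y"
  unfolding free_in_def
proof (intro ballI impI)
  fix u assume u: "u \<in> words_over Y" "eqv R u []"
  then obtain d where d: "d \<in> words_over (Y \<inter> C)" "eqv {} u d"
    using meets_inD[OF assms(1)] words_over_Nil by metis
  then have "eqv R d []"
    using u eqv_empty_mono eqv_sym eqv_trans by blast
  with d assms(2) have "eqv {} d []"
    by (simp add: free_in_def words_over_Int)
  with d show "eqv {} u []" using eqv_trans by blast
qed

section \<open>Amalgamated products\<close>

text \<open>The two groups share letters instead of being joined by a map, so the amalgamated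
  subgroups consist of the same words; \<open>agree\<close> makes the identification of these words
  an isomorphism. The index type \<open>bool\<close> lets one argument serve both factors.\<close>

locale amalgam =
  fixes X :: "bool \<Rightarrow> 'a set" and R :: "bool \<Rightarrow> 'a word set"
  assumes relators: "R i \<subseteq> words_over (X i)"
    and agree: "c \<in> words_over (X True \<inter> X False) \<Longrightarrow> eqv (R i) c [] \<Longrightarrow> eqv (R j) c []"
begin

abbreviation "C \<equiv> words_over (X True \<inter> X False)"

lemma C_words: "c \<in> C \<Longrightarrow> c \<in> words_over (X i)"
  by (cases i) (auto simp: words_over_Int)

lemma C_inv: "c \<in> C \<Longrightarrow> inv_word c \<in> C"
  by (rule inv_word_words_over)

lemma agree_eqv:
  assumes "c \<in> C" "d \<in> C"
  shows "eqv (R i) c d \<longleftrightarrow> eqv (R j) c d"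
  using agree[of "c @ inv_word d"] assms C_inv
  by (subst (1 2) eqv_iff_append_inv_word) (auto simp del: words_over_Int)

text \<open>Representatives are chosen from the whole coset, resp. from the whole congruence class,
  so that they depend only on these; the trivial coset is represented by the empty word.\<close>

definition coset :: "bool \<Rightarrow> 'a word \<Rightarrow> 'a word set" where
  "coset i g = {h \<in> words_over (X i). \<exists>c \<in> C. eqv (R i) h (c @ g)}"

definition rep :: "bool \<Rightarrow> 'a word \<Rightarrow> 'a word" where
  "rep i g = (if [] \<in> coset i g then [] else SOME h. h \<in> coset i g)"

definition cpart :: "bool \<Rightarrow> 'a word \<Rightarrow> 'a word" where
  "cpart i g = (SOME c. c \<in> C \<and> eqv (R i) g (c @ rep i g))"

lemma rep_in_coset: "g \<in> words_over (X i) \<Longrightarrow> rep i g \<in> coset i g"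
proof -
  assume "g \<in> words_over (X i)"
  then have "g \<in> coset i g" by (auto simp: coset_def intro: bexI[of _ "[]"])
  then show ?thesis unfolding rep_def by (auto intro: someI)
qed

lemma rep_words: "g \<in> words_over (X i) \<Longrightarrow> rep i g \<in> words_over (X i)"
  using rep_in_coset by (auto simp: coset_def)

lemma cpart:
  assumes "g \<in> words_over (X i)"
  shows "cpart i g \<in> C" "eqv (R i) g (cpart i g @ rep i g)"
proof -
  obtain c where "c \<in> C" "eqv (R i) (rep i g) (c @ g)"
    using rep_in_coset[OF assms] by (auto simp: coset_def)
  then have "inv_word c \<in> C \<and> eqv (R i) g (inv_word c @ rep i g)"
    using C_inv eqv_move_left[of "R i" "rep i g" c g] eqv_sym by blast
  from someI[where P = "\<lambda>c. c \<in> C \<and> eqv (R i) g (c @ rep i g)", OF this]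
  show "cpart i g \<in> C" "eqv (R i) g (cpart i g @ rep i g)"
    unfolding cpart_def by blast+
qed

lemma rep_cong:
  assumes "d \<in> C" "eqv (R i) g' (d @ g)"
  shows "rep i g' = rep i g"
proof -
  have sub: "coset i g1 \<subseteq> coset i g2" if "d \<in> C" "eqv (R i) g1 (d @ g2)" for g1 g2 d
  proof
    fix h assume "h \<in> coset i g1"
    then obtain c where "h \<in> words_over (X i)" "c \<in> C" "eqv (R i) h (c @ g1)"
      by (auto simp: coset_def)
    with that show "h \<in> coset i g2"
      unfolding coset_def using eqv_appendL[OF that(2), of c] eqv_trans
      by (auto intro!: bexI[of _ "c @ d"])
  qed
  have "eqv (R i) g (inv_word d @ g')"
    using assms(2) eqv_move_left eqv_sym by blast
  with sub[OF assms] sub[OF C_inv[OF assms(1)]] have "coset i g' = coset i g" by blast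
  then show ?thesis by (simp add: rep_def)
qed

lemma rep_cong': "eqv (R i) g' g \<Longrightarrow> rep i g' = rep i g"
  by (rule rep_cong[of "[]"]) auto

lemma rep_Nil: "c \<in> C \<Longrightarrow> rep i c = []"
proof -
  assume "c \<in> C"
  then have "[] \<in> coset i c"
    unfolding coset_def by (auto intro!: bexI[of _ "inv_word c"] C_inv eqv_sym[OF eqv_inv_word_left])
  then show ?thesis by (simp add: rep_def)
qed

lemma cpart_cong: "eqv (R i) g' g \<Longrightarrow> cpart i g' = cpart i g"
  unfolding cpart_def using rep_cong' eqv_trans eqv_sym
  by (metis (no_types, lifting))

text \<open>For a shared word the coset representative is empty, and by \<open>agree\<close> the
  candidates for the remaining choice are the same in both factors. Hence the
  \<open>C\<close>-component of a normal form does not depend on the factor in which it was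
  computed.\<close>

lemma cpart_C: "c \<in> C \<Longrightarrow> cpart i c = (SOME d. d \<in> C \<and> eqv (R True) c d)"
  unfolding cpart_def by (rule arg_cong[where f = Eps]) (auto simp: rep_Nil agree_eqv[of c _ i True])

lemma cpart_C_eq: "c \<in> C \<Longrightarrow> cpart i c = cpart j c"
  by (simp add: cpart_C)

lemma cpart_append_rep:
  assumes "c \<in> C" "rep i r = r"
  shows "cpart i (c @ r) = cpart i c"
proof -
  have "rep i (c @ r) = r" using rep_cong[of c i "c @ r" r] assms by simp
  then show ?thesis
    using assms unfolding cpart_def by (simp add: eqv_cancel_right rep_Nil)
qed

lemma rep_rep: "g \<in> words_over (X i) \<Longrightarrow> rep i (rep i g) = rep i g"
  using rep_in_coset[of g i] rep_cong unfolding coset_def by blast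

lemma cpart_cpart:
  assumes "g \<in> words_over (X i)"
  shows "cpart j (cpart i g) = cpart i g"
proof -
  note g = cpart[OF assms]
  have "cpart i g = cpart i (cpart i g @ rep i g)"
    using cpart_cong g(2) by blast
  also have "\<dots> = cpart i (cpart i g)"
    using cpart_append_rep g(1) rep_rep assms by blast
  finally show ?thesis using cpart_C_eq[OF g(1), of i j] by simp
qed

text \<open>A state \<open>(c, [(i\<^sub>1, r\<^sub>1), \<dots>, (i\<^sub>m, r\<^sub>m)])\<close> stands for the normal form \<open>c r\<^sub>1 \<cdots> r\<^sub>m\<close>,
  with \<open>r\<^sub>j\<close> a nontrivial coset representative in the factor \<open>i\<^sub>j\<close>.\<close>

fun tail_ok :: "bool \<Rightarrow> (bool \<times> 'a word) list \<Rightarrow> bool" where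
  "tail_ok i [] = True"
| "tail_ok i ((j, r) # l) \<longleftrightarrow> j \<noteq> i \<and> r \<in> words_over (X j) \<and> rep j r = r \<and> r \<noteq> [] \<and> tail_ok j l"

text \<open>The fixed point condition selects one word from each congruence class of
  \<open>C\<close>, so that equal elements are recorded by literally equal states.\<close>

definition valid :: "'a word \<times> (bool \<times> 'a word) list \<Rightarrow> bool" where
  "valid s \<longleftrightarrow> fst s \<in> C \<and> (\<forall>i. cpart i (fst s) = fst s) \<and> (\<exists>i. tail_ok i (snd s))"

definition push :: "bool \<Rightarrow> 'a word \<Rightarrow> (bool \<times> 'a word) list \<Rightarrow> 'a word \<times> (bool \<times> 'a word) list" where
  "push i h l = (cpart i h, if rep i h = [] then l else (i, rep i h) # l)"

fun pop :: "bool \<Rightarrow> 'a word \<times> (bool \<times> 'a word) list \<Rightarrow> 'a word \<times> (bool \<times> 'a word) list" where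
  "pop i (c, []) = (c, [])"
| "pop i (c, (j, r) # l) = (if j = i then (c @ r, l) else (c, (j, r) # l))"

text \<open>Left multiplication by an element of factor \<open>i\<close>: a leading syllable of that
  factor is absorbed, the product is formed inside the factor, and the result is split again into a
  shared part and a coset representative.\<close>

definition act :: "bool \<Rightarrow> 'a word \<Rightarrow> 'a word \<times> (bool \<times> 'a word) list \<Rightarrow> 'a word \<times> (bool \<times> 'a word) list" where
  "act i g s = push i (g @ fst (pop i s)) (snd (pop i s))"

lemma pop_ok:
  assumes "valid s"
  shows "fst (pop i s) \<in> words_over (X i)" "tail_ok i (snd (pop i s))"
  using assms C_words by (cases "(i, s)" rule: pop.cases; auto simp: valid_def)+

lemma push_pop: "valid s \<Longrightarrow> push i (fst (pop i s)) (snd (pop i s)) = s"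
  using rep_cong[of "fst s" i "fst s @ snd (hd (snd s))" "snd (hd (snd s))"]
  by (cases "(i, s)" rule: pop.cases)
     (auto simp: valid_def push_def rep_Nil cpart_append_rep)

lemma valid_push: "h \<in> words_over (X i) \<Longrightarrow> tail_ok i l \<Longrightarrow> valid (push i h l)"
  unfolding valid_def push_def
  using cpart(1) cpart_cpart rep_words rep_rep
  by (auto intro: exI[of _ "\<not> i"] exI[of _ i])

lemma pop_push:
  assumes "h \<in> words_over (X i)" "tail_ok i l"
  shows "snd (pop i (push i h l)) = l" "eqv (R i) (fst (pop i (push i h l))) h"
  using assms cpart(2)[OF assms(1), THEN eqv_sym]
  by (cases l; auto simp: push_def)+

lemma push_cong: "eqv (R i) h h' \<Longrightarrow> push i h l = push i h' l"
  using cpart_cong rep_cong' by (metis push_def)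

lemma valid_act: "g \<in> words_over (X i) \<Longrightarrow> valid s \<Longrightarrow> valid (act i g s)"
  unfolding act_def by (rule valid_push) (auto simp: pop_ok)

lemma act_cong: "eqv (R i) g g' \<Longrightarrow> act i g s = act i g' s"
  unfolding act_def by (intro push_cong eqv_appendR)

lemma act_append:
  assumes "g \<in> words_over (X i)" "h \<in> words_over (X i)" "valid s"
  shows "act i g (act i h s) = act i (g @ h) s"
  using pop_push[of "h @ fst (pop i s)" i "snd (pop i s)"] assms pop_ok[OF assms(3), of i]
  unfolding act_def by (auto intro!: push_cong eqv_appendL)

lemma act_Nil: "valid s \<Longrightarrow> act i [] s = s"
  by (simp add: act_def push_pop)

text \<open>A shared element changes only the first component, and in the same way through either
  factor. This makes the action of a letter common to both alphabets unambiguous.\<close>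

lemma act_C:
  assumes "c \<in> C" "valid s"
  shows "act i c s = (cpart True (c @ fst s), snd s)"
  using assms cpart_C_eq[of "c @ fst s" i True] cpart_append_rep[of "c @ fst s" i]
    rep_Nil[of "c @ fst s"] rep_cong[of "c @ fst s" i "c @ fst s @ snd (hd (snd s))" "snd (hd (snd s))"]
  by (cases "(i, s)" rule: pop.cases) (auto simp: act_def push_def valid_def)

text \<open>A derivation may pass through letters of neither factor; they act as the identity, which
  respects cancellation.\<close>

definition act_letter :: "'a letter \<Rightarrow> 'a word \<times> (bool \<times> 'a word) list \<Rightarrow> 'a word \<times> (bool \<times> 'a word) list" where
  "act_letter a s =
     (if fst a \<in> X True then act True [a] s else if fst a \<in> X False then act False [a] s else s)"

definition act_word :: "'a word \<Rightarrow> 'a word \<times> (bool \<times> 'a word) list \<Rightarrow> 'a word \<times> (bool \<times> 'a word) list" where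
  "act_word u s = foldr act_letter u s"

lemma act_letter_eq: "fst a \<in> X i \<Longrightarrow> valid s \<Longrightarrow> act_letter a s = act i [a] s"
  using act_C[of "[a]" s] by (cases i) (auto simp: act_letter_def)

lemma valid_act_word: "valid s \<Longrightarrow> valid (act_word u s)"
  by (induction u) (auto simp: act_word_def act_letter_def intro!: valid_act)

lemma act_word_append: "act_word (u @ v) s = act_word u (act_word v s)"
  by (simp add: act_word_def)

lemma act_word_eq: "u \<in> words_over (X i) \<Longrightarrow> valid s \<Longrightarrow> act_word u s = act i u s"
proof (induction u)
  case (Cons a u)
  then show ?case
    using act_append[of "[a]" i u s]
    using act_letter_eq[OF _ valid_act, of a i u i s] by (simp add: act_word_def)
qed (simp add: act_word_def act_Nil)

lemma act_letter_cancel: "valid s \<Longrightarrow> act_letter a (act_letter (inv_letter a) s) = s"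
  using act_append[of "[a]" _ "[inv_letter a]" s] act_cong[of _ "[a, inv_letter a]" "[]" s]
    eqv.cancel[of _ "[]" a "[]"] act_Nil
  by (auto simp: act_letter_def)

lemma act_word_cong:
  assumes "eqv (R True \<union> R False) u v" "valid s"
  shows "act_word u s = act_word v s"
  using assms
proof (induction arbitrary: s rule: eqv.induct)
  case (cancel u a v)
  then show ?case
    using act_letter_cancel[OF valid_act_word] by (simp add: act_word_def)
next
  case (relator r u v)
  then obtain i where r: "r \<in> R i" by blast
  then have "r \<in> words_over (X i)" using relators by blast
  then have "act_word r (act_word v s) = act_word v s"
    using act_word_eq act_cong[OF eqv_relator_Nil[OF r]] act_Nil valid_act_word relator by simp
  then show ?case by (simp add: act_word_append)
qed auto

text \<open>The normal form of the identity. Its first component is the word chosen for the class of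
  \<open>[]\<close>, which may itself be nonempty.\<close>

definition start :: "'a word \<times> (bool \<times> 'a word) list" where
  "start = (cpart True [], [])"

lemma valid_start: "valid start"
  using cpart(1)[of "[]" True] cpart_cpart[of "[]" True] by (auto simp: valid_def start_def intro: exI[of _ True])

text \<open>A word over factor \<open>i\<close> acts on \<open>start\<close> by multiplication
  inside that factor, so a trivial action forces triviality there.\<close>

theorem factor_embeds:
  assumes "u \<in> words_over (X i)" "eqv (R True \<union> R False) u []"
  shows "eqv (R i) u []"
proof -
  let ?c = "cpart True []"
  have c: "?c \<in> C" using cpart(1) by blast
  have "act i u start = start"
    using act_word_cong[OF assms(2) valid_start] act_word_eq[OF assms(1) valid_start]
    by (simp add: act_word_def)
  then have "push i (u @ ?c) [] = (?c, [])"
    by (simp add: act_def start_def)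
  then have "cpart i (u @ ?c) = ?c" "rep i (u @ ?c) = []"
    by (auto simp: push_def split: if_splits)
  then have "eqv (R i) (u @ ?c) ?c"
    using cpart(2)[of "u @ ?c" i] assms(1) c C_words by simp
  then show ?thesis using eqv_cancel_right[of "R i" u ?c "[]"] by simp
qed

section \<open>Alternating products in the amalgamated product\<close>

fun alternating :: "bool \<Rightarrow> (bool \<times> 'a word) list \<Rightarrow> bool" where
  "alternating i [] = True"
| "alternating i ((j, g) # l) \<longleftrightarrow>
     j \<noteq> i \<and> g \<in> words_over (X j) \<and> \<not> (\<exists>c \<in> C. eqv (R j) g c) \<and> alternating j l"

text \<open>A syllable lies outside the amalgamated subgroup and belongs to a different factor than
  the syllable after it, so acting with it adds exactly one entry and removes none.\<close>

lemma act_word_alternating: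
  assumes "alternating i gs"
  shows "map fst (snd (act_word (concat (map snd gs)) start)) = map fst gs"
  using assms
proof (induction i gs rule: alternating.induct)
  case (1 i)
  then show ?case by (simp add: act_word_def start_def)
next
  case (2 i j g l)
  let ?s = "act_word (concat (map snd l)) start"
  have s: "valid ?s" by (intro valid_act_word valid_start)
  have IH: "map fst (snd ?s) = map fst l" using "2.IH" "2.prems" by (auto simp del: not_iff)
  have l: "pop j ?s = ?s"
  proof (cases "(j, ?s)" rule: pop.cases)
    case (2 i' c j' r l')
    then show ?thesis using IH "2.prems" by (cases l) auto
  qed auto
  have "\<not> (\<exists>c \<in> C. eqv (R j) g c)" and g: "g \<in> words_over (X j)" using 2 by auto
  moreover have "\<exists>c \<in> C. eqv (R j) g c" if "rep j (g @ fst ?s) = []"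
  proof -
    have c: "fst ?s \<in> C" using s by (simp add: valid_def)
    then have h: "g @ fst ?s \<in> words_over (X j)" using g C_words by simp
    have "eqv (R j) (g @ fst ?s) (cpart j (g @ fst ?s))"
      using cpart(2)[OF h] that by simp
    then have "eqv (R j) ((g @ fst ?s) @ inv_word (fst ?s)) (cpart j (g @ fst ?s) @ inv_word (fst ?s))"
      by (rule eqv_appendR)
    moreover have "eqv (R j) (g @ fst ?s @ inv_word (fst ?s)) g"
      using eqv_appendL[OF eqv_inv_word_right, of "R j" g] by simp
    ultimately have "eqv (R j) g (cpart j (g @ fst ?s) @ inv_word (fst ?s))"
      using eqv_sym eqv_trans by fastforce
    then show ?thesis using cpart(1)[OF h] C_inv[OF c] by (metis words_over_append)
  qed
  ultimately have "rep j (g @ fst ?s) \<noteq> []" by blast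
  then show ?case
    using IH l act_word_eq[OF g s] by (simp add: act_word_append act_def push_def)
qed

lemma alternating_eqv_factor:
  assumes "alternating j gs" "eqv (R True \<union> R False) (concat (map snd gs)) v" "v \<in> words_over (X i)"
  shows "gs = [] \<or> (\<exists>g. gs = [(i, g)])"
proof -
  have "act_word (concat (map snd gs)) start = act i v start"
    using act_word_cong[OF assms(2) valid_start] act_word_eq[OF assms(3) valid_start] by simp
  then have "map fst gs = map fst (snd (act i v start))"
    using act_word_alternating[OF assms(1)] by simp
  also have "\<dots> = [] \<or> \<dots> = [i]"
    by (auto simp: act_def push_def start_def)
  finally show ?thesis by (cases gs) auto
qed

text \<open>The word is cut into syllables from alternate factors. A syllable that falls into the
  amalgamated subgroup is, by \<open>meets\<close>, freely equal to a word in letters common to both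
  subsets, and can be merged into a neighbour. The word changes by free cancellation only, and an
  element of a factor leaves room for at most one syllable.\<close>

theorem subamalgam_meets_factor:
  assumes Y: "\<And>i. Y i \<subseteq> X i" and Int: "\<And>i. Y i \<inter> (X True \<inter> X False) \<subseteq> Y (\<not> i)"
    and meets: "\<And>i. meets_in (R i) (Y i) (X True \<inter> X False)"
    and z: "z \<in> words_over (Y True \<union> Y False)"
    and v: "v \<in> words_over (X i)" "eqv (R True \<union> R False) z v"
  obtains y where "y \<in> words_over (Y i)" "eqv {} z y"
proof -
  let ?D = "words_over (Y True \<inter> Y False)"
  have D: "d \<in> words_over (Y j)" if "d \<in> ?D" for d j
    using that by (cases j) (auto simp: words_over_Int)
  have D': "\<exists>d \<in> ?D. eqv {} a d" if "a \<in> words_over (Y j)" "c \<in> C" "eqv (R j) a c" for a c j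
  proof -
    from meets that obtain d where "d \<in> words_over (Y j \<inter> (X True \<inter> X False))" "eqv {} a d"
      by (rule meets_inD)
    moreover have "Y j \<inter> (X True \<inter> X False) \<subseteq> Y True \<inter> Y False"
      using Int[of j] by (cases j) auto
    ultimately show ?thesis using words_over_mono by blast
  qed
  \<comment> \<open>\<open>e\<close> holds shared letters not yet attached to a syllable; the next
    letter on the left absorbs them.\<close>
  have "\<exists>e gs j. e \<in> ?D \<and> alternating j gs \<and> (\<forall>(j, g) \<in> set gs. g \<in> words_over (Y j)) \<and>
          eqv {} z (e @ concat (map snd gs))"
    using z
  proof (induction z)
    case Nil
    show ?case by (intro exI[of _ "[]"] exI[of _ True]) auto
  next
    case (Cons a z)
    then obtain e gs j where IH: "e \<in> ?D" "alternating j gs" "\<forall>(j, g) \<in> set gs. g \<in> words_over (Y j)"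
      "eqv {} z (e @ concat (map snd gs))" by auto
    obtain i where a: "fst a \<in> Y i" using Cons.prems by auto
    obtain g hs where gh: "alternating i hs" "\<forall>(j, g) \<in> set hs. g \<in> words_over (Y j)"
      "g \<in> words_over (Y i)" "concat (map snd gs) = g @ concat (map snd hs)"
    proof (cases gs)
      case (Cons x l)
      show ?thesis
      proof (cases "fst x = i")
        case True
        with Cons IH show ?thesis by (intro that[of l "snd x"]) (cases x; auto)+
      next
        case False
        with Cons IH show ?thesis by (intro that[of gs "[]"]) (cases x; auto)+
      qed
    qed (use that[of "[]" "[]"] in auto)
    define b where "b = a # e @ g"
    have b: "b \<in> words_over (Y i)" using a gh D IH by (simp add: b_def)
    have z: "eqv {} (a # z) (b @ concat (map snd hs))"
      using eqv_appendL[OF IH(4), of "[a]"] by (simp add: b_def gh(4))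
    show ?case
    proof (cases "\<exists>c \<in> C. eqv (R i) b c")
      case True
      then obtain d where "d \<in> ?D" "eqv {} b d" using D'[OF b] by blast
      then show ?thesis using z gh eqv_appendR eqv_trans by blast
    next
      case False
      have "alternating (\<not> i) ((i, b) # hs)"
        using False words_over_mono[OF b Y] gh(1) by simp
      then show ?thesis
        using z gh b by (intro exI[of _ "[]"] exI[of _ "(i, b) # hs"]) auto
    qed
  qed
  then obtain e gs j where e: "e \<in> ?D" and gs: "alternating j gs" "\<forall>(j, g) \<in> set gs. g \<in> words_over (Y j)"
    and zeq: "eqv {} z (e @ concat (map snd gs))" by auto
  have "eqv (R True \<union> R False) v (e @ concat (map snd gs))"
    using v zeq eqv_empty_mono eqv_sym eqv_trans by blast
  then have "eqv (R True \<union> R False) (concat (map snd gs)) (inv_word e @ v)"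
    using eqv_move_left eqv_sym by blast
  moreover have "inv_word e @ v \<in> words_over (X i)"
    using v D[OF e, of i] Y[of i] by (auto intro: words_over_mono inv_word_words_over)
  ultimately have "gs = [] \<or> (\<exists>g. gs = [(i, g)])" using alternating_eqv_factor gs by blast
  then have "e @ concat (map snd gs) \<in> words_over (Y i)" using gs D[OF e, of i] by auto
  with zeq that show ?thesis by blast
qed

end

section \<open>Chains of pieces glued along free subgroups\<close>

lemma amalgam_over_free:
  assumes "R1 \<subseteq> words_over X1" "R2 \<subseteq> words_over X2" "free_in R1 (X1 \<inter> X2)" "free_in R2 (X1 \<inter> X2)"
  shows "amalgam (\<lambda>b. if b then X1 else X2) (\<lambda>b. if b then R1 else R2)"
  using assms by unfold_locales (auto simp: free_in_def intro: eqv_empty_mono split: if_splits)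

text \<open>\<open>overlap\<close> makes the gluing linear: the union of the pieces so far meets the
  next piece only where the last one does.\<close>

locale chain =
  fixes X :: "nat \<Rightarrow> 'a set" and r :: "nat \<Rightarrow> 'a word"
  assumes relator_words: "r j \<in> words_over (X j)"
    and overlap: "i \<le> j \<Longrightarrow> X i \<inter> X (Suc j) \<subseteq> X j"
    and free_left: "free_in {r j} (X j \<inter> X (Suc j))"
    and free_right: "free_in {r (Suc j)} (X j \<inter> X (Suc j))"
begin

definition initial :: "nat \<Rightarrow> 'a set" where
  "initial N = (\<Union>j\<le>N. X j)"

lemma initial_Suc: "initial (Suc N) = initial N \<union> X (Suc N)"
  by (auto simp: initial_def atMost_Suc)

lemma initial_Int: "initial N \<inter> X (Suc N) = X N \<inter> X (Suc N)"
  using overlap by (auto simp: initial_def)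

lemma relators_Suc: "r ` {..Suc N} = r ` {..N} \<union> {r (Suc N)}"
  by (auto simp: atMost_Suc)

lemma relators_words: "r ` {..N} \<subseteq> words_over (initial N)"
  using relator_words by (auto simp: initial_def intro: words_over_mono)

text \<open>Induction on the number of pieces. The hypothesis for the last piece shows that the next
  overlap is still free in the whole initial part; only then can the next amalgamated product be
  formed, and its factors embed.\<close>

theorem piece_embeds:
  assumes "j \<le> N" "u \<in> words_over (X j)" "eqv (r ` {..N}) u []"
  shows "eqv {r j} u []"
  using assms
proof (induction N arbitrary: u j)
  case (Suc N)
  have "free_in (r ` {..N}) (X N \<inter> X (Suc N))"
    using Suc.IH[of N] free_left[of N] by (auto simp: free_in_def words_over_Int)
  then interpret amalgam "\<lambda>b. if b then initial N else X (Suc N)" "\<lambda>b. if b then r ` {..N} else {r (Suc N)}"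
    using relators_words relator_words free_right by (intro amalgam_over_free) (auto simp: initial_Int)
  note emb = factor_embeds[of u True] factor_embeds[of u False]
  show ?case
  proof (cases "j = Suc N")
    case True
    then show ?thesis using emb(2) Suc.prems by (simp add: relators_Suc)
  next
    case False
    then have "u \<in> words_over (initial N)"
      using Suc.prems(1) by (intro words_over_mono[OF Suc.prems(2)]) (auto simp: initial_def le_Suc_eq)
    then show ?thesis using False Suc emb(1) by (simp add: relators_Suc)
  qed
qed simp

lemma free_in_initial: "free_in (r ` {..N}) (X N \<inter> X (Suc N))"
  using piece_embeds[of N N] free_left[of N] by (auto simp: free_in_def words_over_Int)

lemma amalgam_Suc:
  "amalgam (\<lambda>b. if b then initial N else X (Suc N)) (\<lambda>b. if b then r ` {..N} else {r (Suc N)})"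
  using relators_words relator_words free_right free_in_initial
  by (intro amalgam_over_free) (auto simp: initial_Int)

text \<open>An element spelled in \<open>Z\<close> that lies in the last overlap lies in the last
  piece. By the theorem on subamalgams, which rests on the induction hypothesis and the second
  assumption, it is spelled in \<open>Z\<close> within that piece, where the first assumption
  applies.\<close>

lemma meets_in_initial:
  assumes "\<And>j. j \<le> N \<Longrightarrow> meets_in {r j} (Z \<inter> X j) (X j \<inter> X (Suc j))"
    and "\<And>j. Suc j \<le> N \<Longrightarrow> meets_in {r (Suc j)} (Z \<inter> X (Suc j)) (X j \<inter> X (Suc j))"
  shows "meets_in (r ` {..N}) (Z \<inter> initial N) (X N \<inter> X (Suc N))"
  using assms
proof (induction N)
  case 0
  have "initial 0 = X 0" by (simp add: initial_def)
  then show ?case using 0(1)[of 0] by simp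
next
  case (Suc N)
  interpret amalgam "\<lambda>b. if b then initial N else X (Suc N)" "\<lambda>b. if b then r ` {..N} else {r (Suc N)}"
    by (rule amalgam_Suc)
  let ?Y = "\<lambda>b. Z \<inter> (if b then initial N else X (Suc N))"
  have IH: "meets_in (r ` {..N}) (Z \<inter> initial N) (X N \<inter> X (Suc N))"
    using Suc by simp
  show ?case
    unfolding meets_in_def
  proof (intro ballI impI)
    fix u c assume u: "u \<in> words_over (Z \<inter> initial (Suc N))"
      and c: "c \<in> words_over (X (Suc N) \<inter> X (Suc (Suc N)))" and eq: "eqv (r ` {..Suc N}) u c"
    have c': "c \<in> words_over (X (Suc N))" using c by (simp add: words_over_Int)
    obtain y where y: "y \<in> words_over (Z \<inter> X (Suc N))" "eqv {} u y"
    proof (rule subamalgam_meets_factor[of ?Y u c False])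
      fix i show "meets_in (if i then r ` {..N} else {r (Suc N)}) (?Y i)
        ((if True then initial N else X (Suc N)) \<inter> (if False then initial N else X (Suc N)))"
        using IH Suc.prems(2)[of N] by (simp add: initial_Int)
    qed (use u c' eq in \<open>auto simp: relators_Suc initial_Suc Int_Un_distrib\<close>)
    have "eqv (r ` {..Suc N}) y c"
      using eq eqv_empty_mono[OF y(2)] eqv_sym eqv_trans by blast
    then have "eqv (r ` {..Suc N}) (y @ inv_word c) []"
      by (simp only: eqv_iff_append_inv_word[of _ y c, symmetric])
    moreover have "y @ inv_word c \<in> words_over (X (Suc N))"
      using y(1) c' by (simp add: inv_word_words_over words_over_Int)
    ultimately have "eqv {r (Suc N)} y c"
      using piece_embeds[of "Suc N" "Suc N" "y @ inv_word c"]
      by (simp only: eqv_iff_append_inv_word[of _ y c] order_refl)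
    then obtain d where d: "d \<in> words_over ((Z \<inter> X (Suc N)) \<inter> (X (Suc N) \<inter> X (Suc (Suc N))))" "eqv {} y d"
      using meets_inD[OF Suc.prems(1)[of "Suc N"] y(1) c] by auto
    have "(Z \<inter> X (Suc N)) \<inter> (X (Suc N) \<inter> X (Suc (Suc N)))
        \<subseteq> Z \<inter> initial (Suc N) \<inter> (X (Suc N) \<inter> X (Suc (Suc N)))"
      by (auto simp: initial_Suc)
    then show "\<exists>d \<in> words_over (Z \<inter> initial (Suc N) \<inter> (X (Suc N) \<inter> X (Suc (Suc N)))). eqv {} u d"
      using y(2) d eqv_trans words_over_mono by blast
  qed
qed

theorem free_in_subchain:
  assumes "\<And>j. j \<le> N \<Longrightarrow> meets_in {r j} (Z \<inter> X j) (X j \<inter> X (Suc j))"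
    and "\<And>j. Suc j \<le> N \<Longrightarrow> meets_in {r (Suc j)} (Z \<inter> X (Suc j)) (X j \<inter> X (Suc j))"
  shows "free_in (r ` {..N}) (Z \<inter> initial N)"
  using free_in_if_meets_in[OF meets_in_initial[OF assms] free_in_initial] by blast

end

section \<open>The Freiheitssatz\<close>

text \<open>Letters with levels are coded as numbers again, so that rewritten relators keep the type
  \<open>nat word\<close> and the induction on length applies to them.\<close>

definition pr :: "nat \<Rightarrow> int \<Rightarrow> nat" where
  "pr g i = prod_encode (g, int_encode i)"

lemma pr_eq_iff [simp]: "pr g i = pr h j \<longleftrightarrow> g = h \<and> i = j"
  by (simp add: pr_def int_encode_eq)

definition sg :: "bool \<Rightarrow> int" where
  "sg e = (if e then 1 else - 1)"

lemma sg_simps [simp]: "sg True = 1" "sg False = - 1"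
  by (simp_all add: sg_def)

text \<open>Subscript the letters of a word by levels, where passing \<open>g\<close> raises the level by \<open>c g\<close>,
  and drop the letter \<open>z\<close>. With \<open>c\<close> the indicator of \<open>z\<close>, the letter \<open>pr g i\<close> stands for the
  conjugate \<open>z\<^sup>i g z\<^sup>-\<^sup>i\<close>.\<close>

fun rw :: "(nat \<Rightarrow> int) \<Rightarrow> nat \<Rightarrow> int \<Rightarrow> nat word \<Rightarrow> nat word" where
  "rw c z l [] = []"
| "rw c z l ((g, e) # u) =
     (if g = z then [] else [(pr g (if e then l else l - c g), e)]) @ rw c z (l + sg e * c g) u"

text \<open>A weighted exponent sum; when \<open>c\<close> is the indicator of a letter, it is the
  exponent sum of that letter.\<close>

definition lev :: "(nat \<Rightarrow> int) \<Rightarrow> nat word \<Rightarrow> int" where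
  "lev c u = (\<Sum>(g, e) \<leftarrow> u. sg e * c g)"

lemma lev_simps [simp]: "lev c [] = 0" "lev c ((g, e) # u) = sg e * c g + lev c u"
  "lev c (u @ v) = lev c u + lev c v"
  by (simp_all add: lev_def)

lemma rw_append: "rw c z l (u @ v) = rw c z l u @ rw c z (l + lev c u) v"
  by (induction c z l u rule: rw.induct) (auto simp: algebra_simps)

lemma rw_letter:
  "a \<in> set (rw c z l u) \<Longrightarrow> \<exists>g i. fst a = pr g i \<and> g \<noteq> z \<and> (g, snd a) \<in> set u"
  by (induction c z l u rule: rw.induct) (auto split: if_splits)

lemma rw_shift: "(pr g i, e) \<in> set (rw c z (l + j) u) \<longleftrightarrow> (pr g (i - j), e) \<in> set (rw c z l u)"
  by (induction c z l u rule: rw.induct) (auto simp: algebra_simps add.commute)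

lemma letter_in_rw: "(g, e) \<in> set u \<Longrightarrow> g \<noteq> z \<Longrightarrow> \<exists>i. (pr g i, e) \<in> set (rw c z l u)"
  by (induction c z l u rule: rw.induct) auto

lemma length_rw_le: "length (rw c z l u) \<le> length u"
  by (induction c z l u rule: rw.induct) auto

lemma length_rw: "involves u z \<Longrightarrow> length (rw c z l u) < length u"
proof (induction c z l u rule: rw.induct)
  case (2 c z l g e u)
  then show ?case
    using length_rw_le[of c z "l + sg e * c g" u] by (cases "g = z") (auto simp: involves_def)
qed (simp add: involves_def)

text \<open>An inverse letter is subscripted by the level reached after it, so cancelling neighbours
  stay mutually inverse. A relator of level sum 0 leaves the levels to its right unchanged; as it
  may occur at any level, it contributes one rewritten relator for each.\<close>

lemma rw_eqv:
  assumes "eqv R u v" "\<And>r. r \<in> R \<Longrightarrow> lev c r = 0"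
  shows "lev c u = lev c v" "eqv {rw c z l r | l r. r \<in> R} (rw c z l u) (rw c z l v)"
proof -
  have "lev c u = lev c v \<and> (\<forall>l. eqv {rw c z l r | l r. r \<in> R} (rw c z l u) (rw c z l v))"
    using assms(1)
  proof (induction rule: eqv.induct)
    case (cancel u a v)
    obtain g e where a: "a = (g, e)" by (cases a)
    have "rw c z l [a, inv_letter a] =
        (if g = z then [] else [(pr g (if e then l else l - c g), e), inv_letter (pr g (if e then l else l - c g), e)])" for l
      by (auto simp: a inv_letter_def)
    then have "eqv S (rw c z l [a, inv_letter a]) []" for l S
      using eqv.cancel[of S "[]" _ "[]"] by auto
    moreover have "lev c [a, inv_letter a] = 0" "lev c (a # inv_letter a # v) = lev c v"
      by (cases e; auto simp: a inv_letter_def)+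
    ultimately show ?case
      using rw_append[of c z _ u "[a, inv_letter a] @ v"] rw_append[of c z _ "[a, inv_letter a]" v]
      by (auto simp: rw_append intro!: eqv_appendL eqv_appendR[of _ _ "[]", simplified])
  next
    case (relator r u v)
    have "eqv {rw c z l r | l r. r \<in> R} (rw c z l r) []" for l
      using relator by (intro eqv_relator_Nil) auto
    then show ?case using assms(2)[OF relator]
      by (auto simp: rw_append intro!: eqv_appendL eqv_appendR[of _ _ "[]", simplified])
  qed (auto intro: eqv.sym eqv.trans)
  then show "lev c u = lev c v" "eqv {rw c z l r | l r. r \<in> R} (rw c z l u) (rw c z l v)" by auto
qed

text \<open>The first surviving letter is entered at the level reached after an initial power of \<open>z\<close>.\<close>

lemma hd_rw:
  assumes "reduced u" "rw c z l u \<noteq> []"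
  shows "\<exists>g i e m. hd (rw c z l u) = (pr g i, e) \<and> g \<noteq> z \<and>
    (if e then i else i + c g) = l + m * c z \<and>
    (if fst (hd u) = z then m * sg (snd (hd u)) > 0 else hd u = (g, e) \<and> m = 0)"
  using assms
proof (induction c z l u rule: rw.induct)
  case (2 c z l g e u)
  show ?case
  proof (cases "g = z")
    case False
    then show ?thesis by (intro exI[of _ g] exI[of _ "if e then l else l - c g"] exI[of _ e] exI[of _ 0]) auto
  next
    case True
    have u: "reduced u" "u \<noteq> []" "hd u \<noteq> (z, \<not> e)"
      using 2 True by (auto simp: reduced_Cons inv_letter_def)
    with 2 True obtain h i e' m where IH: "hd (rw c z (l + sg e * c z) u) = (pr h i, e')" "h \<noteq> z"
      "(if e' then i else i + c h) = l + sg e * c z + m * c z"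
      "if fst (hd u) = z then m * sg (snd (hd u)) > 0 else hd u = (h, e') \<and> m = 0"
      by (auto simp del: sg_simps)
    have "fst (hd u) = z \<Longrightarrow> snd (hd u) = e" using u(3) by (cases "hd u") auto
    with IH True show ?thesis
      by (intro exI[of _ h] exI[of _ i] exI[of _ e'] exI[of _ "m + sg e"])
         (cases e; auto simp: algebra_simps split: if_splits)
  qed
qed simp

text \<open>Letters that become neighbours by the rewriting enclosed a nonzero power of
  \<open>z\<close>, which moves the level since \<open>c z \<noteq> 0\<close>; so they cannot
  cancel.\<close>

lemma reduced_rw:
  assumes "c z \<noteq> 0" "reduced u"
  shows "reduced (rw c z l u)"
  using assms
proof (induction c z l u rule: rw.induct)
  case (2 c z l g e u)
  let ?l = "l + sg e * c g" and ?i = "if e then l else l - c g"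
  have u: "reduced u" using 2 by (simp add: reduced_Cons)
  have "hd (rw c z ?l u) \<noteq> (pr g ?i, \<not> e)" if "rw c z ?l u \<noteq> []" "g \<noteq> z"
  proof
    assume hd: "hd (rw c z ?l u) = (pr g ?i, \<not> e)"
    from that have "u \<noteq> []" by auto
    then have "hd u \<noteq> (g, \<not> e)" using 2 by (auto simp: reduced_Cons inv_letter_def)
    with hd_rw[OF u that(1)] hd obtain m where "(if \<not> e then ?i else ?i + c g) = ?l + m * c z"
      "m \<noteq> 0" using "2.prems"(1) by (cases "fst (hd u) = z") (auto simp: zero_less_mult_iff)
    then show False using 2 by (cases e) auto
  qed
  then show ?case using 2 u by (auto simp: reduced_Cons inv_letter_def)
qed simp

text \<open>A reduced word of which nothing survives is a power of \<open>z\<close>, and its level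
  is the exponent times \<open>c z\<close>.\<close>

lemma rw_eq_Nil:
  assumes "c z \<noteq> 0" "reduced u" "rw c z l u = []" "lev c u = 0"
  shows "u = []"
proof -
  have "\<exists>m. m * sg (snd (hd u)) > 0 \<and> lev c u = m * c z \<and> fst (hd u) = z" if "u \<noteq> []"
    using assms(2,3) that
  proof (induction c z l u rule: rw.induct)
    case (2 c z l g e u)
    then have g: "g = z" by (auto split: if_splits)
    show ?case
    proof (cases "u = []")
      case True
      with g show ?thesis by (intro exI[of _ "sg e"]) (auto simp: sg_def)
    next
      case False
      with 2 g obtain m where m: "m * sg (snd (hd u)) > 0" "lev c u = m * c z" "fst (hd u) = z"
        by (auto simp: reduced_Cons simp del: sg_simps)
      moreover have "snd (hd u) = e"
        using 2 False g m(3) by (cases "hd u") (auto simp: reduced_Cons inv_letter_def)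
      ultimately show ?thesis using g
        by (intro exI[of _ "sg e + m"]) (cases e; auto simp: algebra_simps)
    qed
  qed simp
  with assms show ?thesis by force
qed

lemma eqv_empty_rw:
  assumes "c z \<noteq> 0" "lev c u = 0" "eqv {} (rw c z l u) []"
  shows "eqv {} u []"
proof -
  have "eqv {} (rw c z l u) (rw c z l (reduce u))"
    using rw_eqv(2)[OF eqv_reduce[of "{}" u]] by simp
  with assms(3) have "reduce (rw c z l (reduce u)) = []"
    by (simp add: eqv_empty_iff reduce_def)
  then have "rw c z l (reduce u) = []"
    using reduced_rw assms(1) by (simp add: reduce_reduced)
  moreover have "lev c (reduce u) = 0"
    using rw_eqv(1)[OF eqv_reduce[of "{}" u]] assms(2) by simp
  ultimately have "reduce u = []"
    using rw_eq_Nil assms(1) by simp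
  then show ?thesis by (simp add: eqv_empty_iff reduce_def)
qed

lemma involves_rw_shift: "involves (rw c z (l + j) u) (pr g i) \<longleftrightarrow> involves (rw c z l u) (pr g (i - j))"
  by (simp add: involves_def rw_shift)

text \<open>\<open>reduced (r @ r)\<close> says that \<open>r\<close> is cyclically reduced. Level
  sum 0 lets both copies be rewritten from the same level, so the rewritten relator inherits the
  property.\<close>

lemma reduced_rw_twice:
  assumes "c z \<noteq> 0" "reduced (r @ r)" "lev c r = 0"
  shows "reduced (rw c z l r @ rw c z l r)"
  using reduced_rw[of c z "r @ r" l] assms by (simp add: rw_append)

text \<open>The relators at consecutive levels form a chain of amalgamated products, in which the
  generator \<open>x\<close> separates the pieces.\<close>

lemma rw_chain:
  fixes r :: "nat word"
  assumes IH: "\<forall>(s :: nat word) y. length s < length r \<longrightarrow> reduced (s @ s) \<longrightarrow> involves s y \<longrightarrow> free_in {s} (UNIV - {y})"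
    and r: "reduced (r @ r)" "lev c r = 0" "c z \<noteq> 0" "involves r z" "involves r x" "x \<noteq> z"
  shows "\<exists>p q. p \<le> q \<and> involves (rw c z 0 r) (pr x p) \<and>
    (\<forall>l. \<forall>u \<in> words_over {y. \<forall>i. y = pr x i \<longrightarrow> p + l \<le> i \<and> i \<le> q + l}.
       eqv (range (\<lambda>l. rw c z l r)) u [] \<longrightarrow> eqv {rw c z l r} u [])"
proof -
  define I where "I = {i. involves (rw c z 0 r) (pr x i)}"
  have "finite (pr x -` fst ` set (rw c z 0 r))"
    by (rule finite_vimageI) (auto simp: inj_on_def)
  then have fin: "finite I"
    by (rule rev_finite_subset) (force simp: I_def involves_def)
  have ne: "I \<noteq> {}"
    using letter_in_rw[of x _ r z c 0] r by (fastforce simp: I_def involves_def)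
  define p q where "p = Min I" and "q = Max I"
  have pq: "p \<in> I" "q \<in> I" "\<And>i. i \<in> I \<Longrightarrow> p \<le> i \<and> i \<le> q"
    using fin ne by (auto simp: p_def q_def)
  \<comment> \<open>Only the subscripts of \<open>x\<close> are confined to a window, which moves
    with \<open>l\<close>; all other letters belong to every piece.\<close>
  define X where "X l = {y. \<forall>i. y = pr x i \<longrightarrow> p + l \<le> i \<and> i \<le> q + l}" for l
  have inv: "involves (rw c z l r) (pr x i) \<longleftrightarrow> i - l \<in> I" for l i
    using involves_rw_shift[of c z 0 l r x i] by (simp add: I_def)
  have words: "rw c z l r \<in> words_over (X l)" for l
    unfolding words_over_def X_def
  proof clarify
    fix y e i assume "(y, e) \<in> set (rw c z l r)" "fst (y, e) = pr x i"
    then have "i - l \<in> I" using inv[of l i] by (cases e) (auto simp: involves_def)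
    then show "p + l \<le> i \<and> i \<le> q + l" using pq(3)[of "i - l"] by simp
  qed
  have free: "free_in {rw c z l r} (UNIV - {pr x (i + l)})" if "i \<in> I" for l i
    using that r by (intro IH[rule_format] length_rw reduced_rw_twice) (auto simp: inv)
  have emb: "eqv {rw c z l r} u []" if u: "u \<in> words_over (X l)" "eqv (range (\<lambda>l. rw c z l r)) u []" for l u
  proof -
    obtain R0 where R0: "R0 \<subseteq> range (\<lambda>l. rw c z l r)" "finite R0" "eqv R0 u []"
      using eqv_finite[OF u(2)] by blast
    then obtain L where L: "finite L" "R0 = (\<lambda>l. rw c z l r) ` L"
      by (meson finite_subset_image)
    define N where "N = Max (abs ` insert l L)"
    have N: "\<bar>j\<bar> \<le> N" if "j \<in> insert l L" for j
      unfolding N_def using that L by (intro Max_ge) auto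
    \<comment> \<open>The levels in use lie between \<open>- N\<close> and \<open>N\<close> and are
      renumbered from 0.\<close>
    let ?f = "\<lambda>j. int j - N"
    interpret chain "\<lambda>j. X (?f j)" "\<lambda>j. rw c z (?f j) r"
    proof
      fix i j :: nat
      show "rw c z (?f j) r \<in> words_over (X (?f j))" by (rule words)
      show "i \<le> j \<Longrightarrow> X (?f i) \<inter> X (?f (Suc j)) \<subseteq> X (?f j)" by (force simp: X_def)
      \<comment> \<open>The overlap misses the lowest subscript of \<open>x\<close> in the left
        relator and the highest one in the right relator, so the induction hypothesis applies to
        both.\<close>
      show "free_in {rw c z (?f j) r} (X (?f j) \<inter> X (?f (Suc j)))"
        by (rule free_in_mono[OF free[OF pq(1)]]) (auto simp: X_def)
      show "free_in {rw c z (?f (Suc j)) r} (X (?f j) \<inter> X (?f (Suc j)))"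
        by (rule free_in_mono[OF free[OF pq(2)]]) (auto simp: X_def)
    qed
    have "R0 \<subseteq> (\<lambda>j. rw c z (?f j) r) ` {..nat (2 * N)}"
    proof
      fix s assume "s \<in> R0"
      then obtain j where j: "j \<in> L" "s = rw c z j r" using L by blast
      then have "\<bar>j\<bar> \<le> N" using N by blast
      then show "s \<in> (\<lambda>j. rw c z (?f j) r) ` {..nat (2 * N)}"
        using j by (intro image_eqI[of _ _ "nat (j + N)"]) auto
    qed
    then have eq: "eqv ((\<lambda>j. rw c z (?f j) r) ` {..nat (2 * N)}) u []"
      using R0 eqv_mono by blast
    have "\<bar>l\<bar> \<le> N" using N by blast
    then have "int (nat (l + N)) - N = l" "nat (l + N) \<le> nat (2 * N)" by auto
    then show ?thesis
      using piece_embeds[of "nat (l + N)" "nat (2 * N)" u] u(1) eq by auto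
  qed
  show ?thesis
    using pq emb by (intro exI[of _ p] exI[of _ q]) (auto simp: I_def X_def)
qed

lemma reduced_appendD: "reduced (u @ v) \<Longrightarrow> reduced u" "reduced (u @ v) \<Longrightarrow> reduced v"
  by (auto simp: reduced_def successively_append_iff)

text \<open>After a leading power of \<open>z\<close> the first surviving letter would have a
  nonzero level; the last letter guarantees that one survives. So the first letter is not
  \<open>z\<close> and can be stripped off.\<close>

lemma level_zero_no_stable_letter:
  assumes c: "c = (\<lambda>g. if g = z then 1 else 0)"
    and "reduced u" "fst (last u) \<noteq> z"
    and "\<And>g i e. (pr g i, e) \<in> set (rw c z 0 u) \<Longrightarrow> i = 0"
  shows "z \<notin> fst ` set u"
  using assms(2-)
proof (induction u)
  case (Cons a u)
  obtain g e where a: "a = (g, e)" by (cases a)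
  have g: "g \<noteq> z"
  proof
    assume gz: "g = z"
    have "fst (last (a # u)) \<in> fst ` set (a # u)" by (metis image_eqI last_in_set list.distinct(1))
    then have "rw c z 0 (a # u) \<noteq> []"
      using letter_in_rw[of "fst (last (a # u))" "snd (last (a # u))" "a # u" z c 0] Cons.prems(2)
      by (metis empty_iff empty_set last_in_set list.distinct(1) prod.collapse)
    from hd_rw[OF Cons.prems(1) this] gz a obtain h i e' m where
      "hd (rw c z 0 (a # u)) = (pr h i, e')" "h \<noteq> z" "(if e' then i else i + c h) = m * c z" "m * sg e > 0"
      by auto
    moreover from this have "i = 0"
      using Cons.prems(3) hd_in_set[OF \<open>rw c z 0 (a # u) \<noteq> []\<close>] by metis
    ultimately show False by (auto simp: c split: if_splits)
  qed
  show ?case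
  proof (cases "u = []")
    case False
    then have "z \<notin> fst ` set u"
      using Cons.prems a g by (intro Cons.IH) (auto simp: reduced_Cons c)
    then show ?thesis using a g by auto
  qed (use a g in auto)
qed simp

text \<open>Between an occurrence of \<open>x\<close> and its copy in \<open>r @ r\<close> the level has to return to its
  value at \<open>x\<close>, but by the preceding lemma it cannot be constant in between.\<close>

lemma some_level_nonzero:
  assumes c: "c = (\<lambda>g. if g = z then 1 else 0)"
    and r: "reduced (r @ r)" "lev c r = 0" "involves r z" "involves r x" "x \<noteq> z"
  shows "\<exists>g i. involves (rw c z l r) (pr g i) \<and> i \<noteq> 0"
proof (rule ccontr)
  assume neg: "\<not> ?thesis"
  have zero: "i = 0" if "(pr g i, e) \<in> set (rw c z l r)" for g i e
    using neg that by (cases e) (auto simp: involves_def)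
  obtain e where "(x, e) \<in> set r" using r by (auto simp: involves_def)
  then obtain v v' where v: "r = v @ (x, e) # v'" by (meson split_list)
  let ?q = "(x, e) # v' @ v @ [(x, e)]"
  have rr: "r @ r = v @ ?q @ v'" by (simp add: v)
  have "rw c z l (r @ r) = rw c z l r @ rw c z l r" using r by (simp add: rw_append)
  then have z2: "i = 0" if "(pr g i, e) \<in> set (rw c z l (r @ r))" for g i e
    using that zero by auto
  have l: "l + lev c v = 0"
    using z2[of x "l + lev c v" e] r(5) unfolding rr by (auto simp: rw_append c)
  have "reduced ?q"
    using reduced_appendD(2)[of v "?q @ v'"] reduced_appendD(1)[of ?q v'] r(1) unfolding rr by simp
  moreover have "i = 0" if "(pr g i, e) \<in> set (rw c z 0 ?q)" for g i e
    using z2[of g i e] that unfolding rr rw_append[of c z l v] rw_append[of c z _ ?q] l by auto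
  ultimately have "z \<notin> fst ` set ?q"
    using r(5) by (intro level_zero_no_stable_letter[OF c]) auto
  moreover have "z \<in> fst ` set r" using r(3) by (force simp: involves_def)
  ultimately show False by (auto simp: v)
qed

text \<open>A word without \<open>t\<close> is rewritten so that it lies in a single piece of the
  chain of rewritten relators and misses a letter of the shorter relator there. The letter
  eliminated is \<open>t\<close> if its exponent sum is 0, and another letter \<open>x\<close>
  otherwise.\<close>

theorem freiheitssatz:
  fixes r :: "nat word"
  assumes "reduced (r @ r)" "involves r t"
  shows "free_in {r} (UNIV - {t})"
  using assms
proof (induction "length r" arbitrary: r t rule: less_induct)
  case less
  have IH: "\<forall>(s :: nat word) y. length s < length r \<longrightarrow> reduced (s @ s) \<longrightarrow> involves s y \<longrightarrow> free_in {s} (UNIV - {y})"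
    using less.hyps by blast
  show ?case
  proof (cases "\<exists>x. x \<noteq> t \<and> involves r x")
    case False
    \<comment> \<open>Deleting \<open>t\<close> kills a relator that involves no other letter and
      fixes the words without \<open>t\<close>.\<close>
    let ?f = "\<lambda>a :: nat letter. if fst a = t then [] else [a]"
    have fr: "concat (map ?f r) = []"
    proof -
      have "fst a = t" if "a \<in> set r" for a
        using False that by (cases a; cases "snd a") (auto simp: involves_def)
      then show ?thesis by auto
    qed
    show ?thesis
      unfolding free_in_def
    proof (intro ballI impI)
      fix u assume u: "u \<in> words_over (UNIV - {t})" "eqv {r} u []"
      have "eqv {} (concat (map ?f u)) (concat (map ?f []))"
        using eqv.cancel[of "{}" "[]" _ "[]"] by (intro eqv_subst[OF u(2)]) (auto simp: fr)
      moreover have "concat (map ?f u) = u" using u(1) by (induction u) auto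
      ultimately show "eqv {} u []" by simp
    qed
  next
    case True
    then obtain x where x: "x \<noteq> t" "involves r x" by blast
    define es where "es y = lev (\<lambda>g. if g = y then 1 else 0) r" for y
    show ?thesis
    proof (cases "es t = 0")
      case True
      define c where "c = (\<lambda>g. if g = t then 1 else 0 :: int)"
      have lev: "lev c r = 0" and ct: "c t \<noteq> 0" using True by (simp_all add: es_def c_def)
      obtain p q where pq: "p \<le> q" "involves (rw c t 0 r) (pr x p)" and
        emb: "\<forall>l. \<forall>u \<in> words_over {y. \<forall>i. y = pr x i \<longrightarrow> p + l \<le> i \<and> i \<le> q + l}.
          eqv (range (\<lambda>l. rw c t l r)) u [] \<longrightarrow> eqv {rw c t l r} u []"
        using rw_chain[OF IH less.prems(1) lev ct less.prems(2) x(2,1)]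
        by (elim exE conjE) (rule that; assumption)
      \<comment> \<open>A word without \<open>t\<close> stays at level 0. Starting the relator at
        level \<open>- p\<close> puts 0 into its window for \<open>x\<close>; a letter of it with
        nonzero subscript is avoided by such a word.\<close>
      obtain g i where gi: "involves (rw c t (- p) r) (pr g i)" "i \<noteq> 0"
        using some_level_nonzero[OF c_def less.prems(1) lev less.prems(2) x(2,1)] by blast
      have free: "free_in {rw c t (- p) r} (UNIV - {pr g i})"
        using less.prems lev ct gi by (intro IH[rule_format] length_rw reduced_rw_twice) auto
      show ?thesis
        unfolding free_in_def
      proof (intro ballI impI)
        fix u assume u: "u \<in> words_over (UNIV - {t})" "eqv {r} u []"
        have "fst a \<in> range (\<lambda>g. pr g 0)" if "a \<in> set (rw c t 0 u)" for a
          using u(1) that by (induction u) (auto simp: c_def)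
        then have lvl: "fst ` set (rw c t 0 u) \<subseteq> range (\<lambda>g. pr g 0)" by blast
        have "{rw c t l r' | l r'. r' \<in> {r}} = range (\<lambda>l. rw c t l r)" by auto
        then have "eqv (range (\<lambda>l. rw c t l r)) (rw c t 0 u) []"
          using rw_eqv(2)[OF u(2), of c t 0] lev by simp
        moreover have "rw c t 0 u \<in> words_over {y. \<forall>i. y = pr x i \<longrightarrow> p + - p \<le> i \<and> i \<le> q + - p}"
          using lvl pq by (fastforce simp: words_over_def)
        ultimately have "eqv {rw c t (- p) r} (rw c t 0 u) []" using emb by blast
        moreover have "rw c t 0 u \<in> words_over (UNIV - {pr g i})"
          using lvl gi by (fastforce simp: words_over_def)
        ultimately have "eqv {} (rw c t 0 u) []" using free by (auto simp: free_in_def)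
        then show "eqv {} u []"
          using eqv_empty_rw[of c t u 0] rw_eqv(1)[OF u(2), of c] lev ct by simp
      qed
    next
      case False
      \<comment> \<open>The levels amount to substituting \<open>t \<mapsto> t z\<^sup>-\<^sup>\<beta>\<close> and \<open>x \<mapsto> z\<^sup>\<alpha>\<close> for a new letter \<open>z\<close>, where
        \<open>\<alpha>\<close> and \<open>\<beta>\<close> are the exponent sums of \<open>t\<close> and \<open>x\<close> in \<open>r\<close>, so that \<open>z\<close> has exponent sum \<open>0\<close>.\<close>
      define c where "c g = (if g = x then es t else if g = t then - es x else 0)" for g
      have "lev c u = es t * lev (\<lambda>g. if g = x then 1 else 0) u - es x * lev (\<lambda>g. if g = t then 1 else 0) u" for u
        using x(1) by (induction u) (auto simp: c_def algebra_simps)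
      then have lev: "lev c r = 0" by (simp add: es_def)
      have cx: "c x \<noteq> 0" using False by (simp add: c_def)
      obtain p q where pq: "p \<le> q" "involves (rw c x 0 r) (pr t p)" and
        emb: "\<forall>l. \<forall>u \<in> words_over {y. \<forall>i. y = pr t i \<longrightarrow> p + l \<le> i \<and> i \<le> q + l}.
          eqv (range (\<lambda>l. rw c x l r)) u [] \<longrightarrow> eqv {rw c x l r} u []"
        using rw_chain[OF IH less.prems(1) lev cx x(2) less.prems(2) x(1)[symmetric]]
        by (elim exE conjE) (rule that; assumption)
      \<comment> \<open>A word without \<open>t\<close> has no subscripted \<open>t\<close> after
        rewriting, so it meets the window condition and avoids \<open>pr t p\<close>.\<close>
      have free: "free_in {rw c x 0 r} (UNIV - {pr t p})"
        using less.prems lev cx x pq by (intro IH[rule_format] length_rw reduced_rw_twice) auto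
      show ?thesis
        unfolding free_in_def
      proof (intro ballI impI)
        fix u assume u: "u \<in> words_over (UNIV - {t})" "eqv {r} u []"
        have no_t: "fst ` set (rw c x 0 u) \<subseteq> {y. \<forall>i. y \<noteq> pr t i}"
          using u(1) by (fastforce simp: words_over_def dest: rw_letter)
        have "{rw c x l r' | l r'. r' \<in> {r}} = range (\<lambda>l. rw c x l r)" by auto
        then have "eqv (range (\<lambda>l. rw c x l r)) (rw c x 0 u) []"
          using rw_eqv(2)[OF u(2), of c x 0] lev by simp
        moreover have "rw c x 0 u \<in> words_over {y. \<forall>i. y = pr t i \<longrightarrow> p + 0 \<le> i \<and> i \<le> q + 0}"
          using no_t unfolding words_over_def by blast
        ultimately have "eqv {rw c x 0 r} (rw c x 0 u) []" using emb by blast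
        moreover have "rw c x 0 u \<in> words_over (UNIV - {pr t p})"
          using no_t by (auto simp: words_over_def)
        ultimately have "eqv {} (rw c x 0 u) []" using free by (auto simp: free_in_def)
        then show "eqv {} u []"
          using eqv_empty_rw[of c x u 0] rw_eqv(1)[OF u(2), of c] lev cx by simp
      qed
    qed
  qed
qed

section \<open>Presented groups and Magnus subgroups\<close>

lemma carrier_free_group: "u \<in> carrier (free_group X) \<longleftrightarrow> u \<in> words_over X \<and> reduced u"
  and mult_free_group: "u \<otimes>\<^bsub>free_group X\<^esub> v = reduce (u @ v)"
  and one_free_group: "\<one>\<^bsub>free_group X\<^esub> = []"
  by (simp_all add: free_group_def)

lemma reduce_in_free_group: "u \<in> words_over X \<Longrightarrow> reduce u \<in> carrier (free_group X)"
  by (simp add: carrier_free_group reduce_words_over)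

lemma inv_free_group:
  assumes "u \<in> carrier (free_group X)"
  shows "inv\<^bsub>free_group X\<^esub> u = reduce (inv_word u)"
proof -
  interpret group "free_group X" by (rule group_free_group)
  show ?thesis
    using assms reduce_inv_word_append[of u]
    by (intro inv_equality)
       (auto simp: mult_free_group one_free_group carrier_free_group reduce_append_left
          reduce_words_over inv_word_words_over)
qed

lemma normal_closure_iff:
  assumes R: "R \<subseteq> carrier (free_group X)"
  shows "u \<in> normal_closure (free_group X) R \<longleftrightarrow> u \<in> carrier (free_group X) \<and> eqv R u []"
proof
  interpret group "free_group X" by (rule group_free_group)
  let ?K = "{u \<in> carrier (free_group X). eqv R u []}"
  have red: "eqv R (reduce u) v \<longleftrightarrow> eqv R u v" for u v
    using eqv_reduce eqv_sym eqv_trans by blast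
  have inv: "eqv R (inv_word u) []" if "eqv R u []" for u
    using eqv_move_left[of R "[]" u "[]"] eqv_sym[OF that] by simp
  have "subgroup ?K (free_group X)"
  proof (rule subgroupI)
    have "[] \<in> ?K" by (simp add: carrier_free_group)
    then show "?K \<noteq> {}" by blast
    fix u v assume "u \<in> ?K" "v \<in> ?K"
    then show "u \<otimes>\<^bsub>free_group X\<^esub> v \<in> ?K"
      using eqv_append[of R u "[]" v "[]"]
      by (auto simp: mult_free_group red carrier_free_group reduce_words_over)
  qed (auto simp: inv_free_group red inv carrier_free_group reduce_words_over inv_word_words_over)
  moreover have "eqv R (u @ h @ inv_word u) []" if "eqv R h []" for u h
    using eqv_trans[OF eqv_context[OF that, of u "inv_word u"]] by simp
  ultimately have "?K \<lhd> free_group X"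
    by (auto simp: normal_inv_iff mult_free_group inv_free_group reduce_append_left
        reduce_append_right red carrier_free_group reduce_words_over inv_word_words_over)
  moreover have "R \<subseteq> ?K" using R eqv_relator_Nil by blast
  ultimately have "normal_closure (free_group X) R \<subseteq> ?K"
    unfolding normal_closure_def by blast
  then show "u \<in> normal_closure (free_group X) R \<Longrightarrow> u \<in> carrier (free_group X) \<and> eqv R u []"
    by blast
next
  interpret group "free_group X" by (rule group_free_group)
  let ?N = "normal_closure (free_group X) R" and ?F = "free_group X"
  interpret normal ?N ?F by (rule normal_closure_normal[OF R])
  \<comment> \<open>A derivation may use letters outside \<open>X\<close>. Deleting them turns each
    step into an equality of cosets in the free group on \<open>X\<close>.\<close>
  define f where "f u = reduce (filter (\<lambda>a. fst a \<in> X) u)" for u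
  have f: "f u \<in> carrier ?F" for u
    unfolding f_def by (rule reduce_in_free_group) (auto simp: words_over_def)
  have f_append: "f (u @ v) = f u \<otimes>\<^bsub>?F\<^esub> f v" for u v
    by (simp add: f_def mult_free_group reduce_append_left reduce_append_right)
  have f_id: "f u = u" if "u \<in> carrier ?F" for u
  proof -
    have "filter (\<lambda>a. fst a \<in> X) u = u"
      using that by (auto simp: carrier_free_group words_over_def intro!: filter_True)
    then show ?thesis using that by (simp add: f_def carrier_free_group reduce_reduced)
  qed
  have cosets: "?N #>\<^bsub>?F\<^esub> f u = ?N #>\<^bsub>?F\<^esub> f v" if "eqv R u v" for u v
    using that
  proof (induction rule: eqv.induct)
    case (cancel u a v)
    have "f (u @ a # inv_letter a # v) = f (u @ v)" by (simp add: f_def reduce_cancel)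
    then show ?case by simp
  next
    case (relator r u v)
    have "r \<in> ?N" using relator by (auto simp: normal_closure_def)
    moreover have "f r = r" using relator R f_id by blast
    moreover have "f [] \<in> ?N"
      using one_closed f_id[of "[]"] by (simp add: one_free_group carrier_free_group)
    ultimately have "?N #>\<^bsub>?F\<^esub> f r = ?N #>\<^bsub>?F\<^esub> f []"
      using coset_join2[OF f[of r] is_subgroup] coset_join2[OF f[of "[]"] is_subgroup] by simp
    then have "(?N #>\<^bsub>?F\<^esub> f r) <#>\<^bsub>?F\<^esub> (?N #>\<^bsub>?F\<^esub> f v) = ?N #>\<^bsub>?F\<^esub> f v"
      using f_append[of "[]" v] by (simp add: rcos_sum f)
    then have "(?N #>\<^bsub>?F\<^esub> f u) <#>\<^bsub>?F\<^esub> ((?N #>\<^bsub>?F\<^esub> f r) <#>\<^bsub>?F\<^esub> (?N #>\<^bsub>?F\<^esub> f v)) =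
        (?N #>\<^bsub>?F\<^esub> f u) <#>\<^bsub>?F\<^esub> (?N #>\<^bsub>?F\<^esub> f v)"
      by simp
    then show ?case by (simp add: f_append rcos_sum f)
  qed auto
  assume u: "u \<in> carrier ?F \<and> eqv R u []"
  then have "?N #>\<^bsub>?F\<^esub> u = ?N #>\<^bsub>?F\<^esub> \<one>\<^bsub>?F\<^esub>"
    using cosets[of u "[]"] f_id[of u] f_id[of "[]"] by (simp add: one_free_group carrier_free_group)
  then show "u \<in> ?N"
    using u rcos_self[OF _ is_subgroup, of u] by (simp add: subset)
qed

text \<open>The elements of a presented group: a coset of the normal closure is a congruence class
  cut down to the reduced words over \<open>X\<close>.\<close>

definition cls :: "'a set \<Rightarrow> 'a word set \<Rightarrow> 'a word \<Rightarrow> 'a word set" where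
  "cls X R u = {v \<in> carrier (free_group X). eqv R v u}"

lemma cls_reduce: "cls X R (reduce u) = cls X R u"
  unfolding cls_def using eqv_reduce eqv_sym eqv_trans by blast

lemma reduce_in_cls: "u \<in> words_over X \<Longrightarrow> reduce u \<in> cls X R u"
  unfolding cls_def using eqv_reduce eqv_sym reduce_in_free_group by blast

lemma cls_eq_iff:
  assumes "u \<in> words_over X"
  shows "cls X R u = cls X R v \<longleftrightarrow> eqv R u v"
proof
  assume "cls X R u = cls X R v"
  then have "eqv R (reduce u) v" using reduce_in_cls[OF assms] by (auto simp: cls_def)
  then show "eqv R u v" using eqv_reduce eqv_trans by blast
next
  assume "eqv R u v"
  then show "cls X R u = cls X R v" unfolding cls_def using eqv_sym eqv_trans by blast
qed

context
  fixes X :: "'a set" and R :: "'a word set"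
  assumes R: "R \<subseteq> carrier (free_group X)"
begin

lemma normal_relators: "normal_closure (free_group X) R \<lhd> free_group X"
  using group.normal_closure_normal[OF group_free_group R] .

lemma r_coset_eq_cls:
  assumes "u \<in> words_over X"
  shows "normal_closure (free_group X) R #>\<^bsub>free_group X\<^esub> reduce u = cls X R u"
proof (intro equalityI subsetI)
  fix v assume "v \<in> normal_closure (free_group X) R #>\<^bsub>free_group X\<^esub> reduce u"
  then obtain h where h: "h \<in> carrier (free_group X)" "eqv R h []" "v = reduce (h @ u)"
    by (auto simp: r_coset_def normal_closure_iff[OF R] mult_free_group reduce_append_right)
  then have "eqv R v (h @ u)" "eqv R (h @ u) u"
    using eqv_sym[OF eqv_reduce[of R "h @ u"]] eqv_appendR[of R h "[]" u] by simp_all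
  then have "eqv R v u" by (rule eqv_trans)
  then show "v \<in> cls X R u"
    using h assms by (auto simp: cls_def carrier_free_group intro: reduce_words_over)
next
  fix v assume "v \<in> cls X R u"
  then have v: "v \<in> carrier (free_group X)" "eqv R v u" by (auto simp: cls_def)
  let ?h = "reduce (v @ inv_word u)"
  have "eqv R ?h []"
    using v eqv_iff_append_inv_word[of R v u] eqv_reduce[of R "v @ inv_word u"] eqv_sym eqv_trans by blast
  moreover have "?h \<in> carrier (free_group X)"
    using v assms by (intro reduce_in_free_group) (auto simp: carrier_free_group inv_word_words_over)
  moreover have "reduce (?h @ reduce u) = v"
    using v reduce_append_right[of v "inv_word u @ u"] reduce_inv_word_append[of u]
    by (simp add: reduce_append_left reduce_append_right carrier_free_group reduce_reduced)
  ultimately show "v \<in> normal_closure (free_group X) R #>\<^bsub>free_group X\<^esub> reduce u"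
    unfolding r_coset_def by (auto simp: normal_closure_iff[OF R] mult_free_group intro!: bexI[of _ ?h])
qed

lemma carrier_presented_group: "carrier (presented_group X R) = cls X R ` words_over X"
proof -
  have "u \<in> carrier (free_group X) \<Longrightarrow> reduce u = u \<and> u \<in> words_over X" for u :: "'a word"
    by (simp add: carrier_free_group reduce_reduced)
  then have "normal_closure (free_group X) R #>\<^bsub>free_group X\<^esub> u = cls X R u"
    if "u \<in> carrier (free_group X)" for u
    using that r_coset_eq_cls by metis
  moreover have "cls X R u \<in> cls X R ` carrier (free_group X)" if "u \<in> words_over X" for u
    using that cls_reduce[of X R u] reduce_in_free_group by (metis image_eqI)
  ultimately show ?thesis
    by (auto simp: presented_group_def FactGroup_def RCOSETS_def carrier_free_group image_iff)
qed

lemma mult_presented_group: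
  assumes "u \<in> words_over X" "v \<in> words_over X"
  shows "cls X R u \<otimes>\<^bsub>presented_group X R\<^esub> cls X R v = cls X R (u @ v)"
proof -
  have "(normal_closure (free_group X) R #>\<^bsub>free_group X\<^esub> reduce u) <#>\<^bsub>free_group X\<^esub>
      (normal_closure (free_group X) R #>\<^bsub>free_group X\<^esub> reduce v) =
      normal_closure (free_group X) R #>\<^bsub>free_group X\<^esub> reduce (u @ v)"
    using normal.rcos_sum[OF normal_relators reduce_in_free_group reduce_in_free_group] assms
    by (simp add: mult_free_group reduce_append_left reduce_append_right)
  then show ?thesis
    using assms by (simp add: r_coset_eq_cls presented_group_def FactGroup_def)
qed

lemma one_presented_group: "\<one>\<^bsub>presented_group X R\<^esub> = cls X R []"
  using normal_closure_iff[OF R] by (auto simp: presented_group_def FactGroup_def cls_def)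

lemma generator_eq_cls: "x \<in> X \<Longrightarrow> generator X R x = cls X R [(x, True)]"
  using r_coset_eq_cls[of "[(x, True)]"] by (simp add: generator_def reduce_def)

lemma inv_presented_group:
  assumes "u \<in> words_over X"
  shows "inv\<^bsub>presented_group X R\<^esub> (cls X R u) = cls X R (inv_word u)"
proof -
  interpret group "presented_group X R" by (rule group_presented_group[OF R])
  have u: "inv_word u \<in> words_over X" using assms by (rule inv_word_words_over)
  have "cls X R (inv_word u @ u) = cls X R []" using assms u by (simp add: cls_eq_iff)
  then show ?thesis
    using assms u
    by (intro inv_equality) (auto simp: mult_presented_group one_presented_group carrier_presented_group)
qed

lemma generate_generators:
  assumes Y: "Y \<subseteq> X"
  shows "generate (presented_group X R) (generator X R ` Y) = cls X R ` words_over Y"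
proof (intro equalityI subsetI)
  have sub: "words_over Y \<subseteq> words_over X" using Y words_over_mono by blast
  fix g assume "g \<in> generate (presented_group X R) (generator X R ` Y)"
  then show "g \<in> cls X R ` words_over Y"
  proof (induction rule: generate.induct)
    case one
    show ?case by (auto simp: one_presented_group)
  next
    case (incl h)
    then obtain x where "x \<in> Y" "h = generator X R x" by blast
    then show ?case using Y by (auto simp: generator_eq_cls subset_iff intro!: imageI)
  next
    case (inv h)
    then obtain x where x: "x \<in> Y" "h = generator X R x" by blast
    then have "inv\<^bsub>presented_group X R\<^esub> h = cls X R (inv_word [(x, True)])"
      using Y by (auto simp: generator_eq_cls inv_presented_group subset_iff)
    then show ?case using x by (auto simp: inv_word_def intro!: imageI)
  next
    case (eng g h)
    then obtain u v where "u \<in> words_over Y" "g = cls X R u" "v \<in> words_over Y" "h = cls X R v" by blast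
    then show ?case using sub by (auto simp: mult_presented_group subset_iff intro!: imageI)
  qed
next
  fix g assume "g \<in> cls X R ` words_over Y"
  then obtain u where "u \<in> words_over Y" "g = cls X R u" by blast
  then show "g \<in> generate (presented_group X R) (generator X R ` Y)"
  proof (induction u arbitrary: g)
    case Nil
    then show ?case using generate.one[of "presented_group X R"] by (simp add: one_presented_group)
  next
    case (Cons a u)
    obtain x e where a: "a = (x, e)" by (cases a)
    with Cons Y have x: "x \<in> Y" "x \<in> X" and u: "u \<in> words_over X" by (auto intro: words_over_mono)
    have "cls X R [a] \<in> generate (presented_group X R) (generator X R ` Y)"
    proof (cases e)
      case True
      then show ?thesis using x a by (auto simp: generator_eq_cls[symmetric] intro: generate.incl)
    next
      case False
      have "inv\<^bsub>presented_group X R\<^esub> (generator X R x) = cls X R [a]"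
        using False a x by (simp add: generator_eq_cls inv_presented_group inv_word_def inv_letter_def)
      then show ?thesis using x generate.inv[of "generator X R x" "generator X R ` Y" "presented_group X R"] by simp
    qed
    moreover have "cls X R [a] \<otimes>\<^bsub>presented_group X R\<^esub> cls X R u = g"
      using mult_presented_group[of "[a]" u] u x a Cons.prems by simp
    ultimately show ?case using Cons generate.eng by fastforce
  qed
qed

end

text \<open>Here \<open>d\<close> agrees with \<open>u\<close> only modulo \<open>r\<close>; the
  Freiheitssatz later turns this into free equality.\<close>

lemma words_if_not_exceptional:
  assumes "r \<in> carrier (free_group X)" "Y1 \<subseteq> X" "Y2 \<subseteq> X" "\<not> exceptional_intersection X r Y1 Y2"
    and "u \<in> words_over Y1" "v \<in> words_over Y2" "eqv {r} u v"
  obtains d where "d \<in> words_over (Y1 \<inter> Y2)" "eqv {r} u d"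
proof -
  have r: "{r} \<subseteq> carrier (free_group X)" using assms by simp
  have u: "u \<in> words_over X" using assms words_over_mono by blast
  have m: "magnus_subgroup X r Y = cls X {r} ` words_over Y" if "Y \<subseteq> X" for Y
    unfolding magnus_subgroup_def by (rule generate_generators[OF r that])
  have "cls X {r} u = cls X {r} v" using u assms by (simp add: cls_eq_iff)
  then have "cls X {r} u \<in> cls X {r} ` words_over Y1 \<inter> cls X {r} ` words_over Y2"
    using assms(5,6) by blast
  then have "cls X {r} u \<in> magnus_subgroup X r Y1 \<inter> magnus_subgroup X r Y2"
    using assms by (simp add: m)
  then have "cls X {r} u \<in> magnus_subgroup X r (Y1 \<inter> Y2)"
    using assms(4) unfolding exceptional_intersection_def by blast
  then have "cls X {r} u \<in> cls X {r} ` words_over (Y1 \<inter> Y2)"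
    using m[of "Y1 \<inter> Y2"] assms(2) by blast
  then show thesis using that u by (auto simp: cls_eq_iff)
qed

lemma presented_group_mon:
  assumes X: "X \<subseteq> X'" and R: "R \<subseteq> carrier (free_group X)" and R': "R' \<subseteq> carrier (free_group X')"
    and "R \<subseteq> R'" and emb: "\<And>u. u \<in> words_over X \<Longrightarrow> eqv R' u [] \<Longrightarrow> eqv R u []"
  shows "\<exists>h \<in> mon (presented_group X R) (presented_group X' R').
           \<forall>x \<in> X. h (generator X R x) = generator X' R' x"
proof -
  \<comment> \<open>For a class \<open>A\<close> all sets in the union coincide, so no
    representative has to be chosen.\<close>
  define h where "h A = (\<Union>u \<in> A. cls X' R' u)" for A
  have words: "u \<in> words_over X'" if "u \<in> words_over X" for u
    using that X words_over_mono by blast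
  have h: "h (cls X R u) = cls X' R' u" if "u \<in> words_over X" for u
  proof -
    have "cls X' R' v = cls X' R' u" if "v \<in> cls X R u" for v
      using that words eqv_mono[OF _ \<open>R \<subseteq> R'\<close>] by (auto simp: cls_def[of X] carrier_free_group cls_eq_iff)
    then show ?thesis using reduce_in_cls[OF that, of R] by (auto simp: h_def)
  qed
  have "eqv R u v" if "u \<in> words_over X" "v \<in> words_over X" "eqv R' u v" for u v
    using emb[of "u @ inv_word v"] that eqv_iff_append_inv_word[of R u v] eqv_iff_append_inv_word[of R' u v]
    by (simp only: words_over_append inv_word_words_over simp_thms)
  then have "inj_on h (carrier (presented_group X R))"
    using words by (auto simp: inj_on_def carrier_presented_group[OF R] h cls_eq_iff)
  moreover have "h \<in> hom (presented_group X R) (presented_group X' R')"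
    using words by (intro homI) (auto simp: carrier_presented_group[OF R] carrier_presented_group[OF R']
        mult_presented_group[OF R] mult_presented_group[OF R'] h)
  moreover have "\<forall>x \<in> X. h (generator X R x) = generator X' R' x"
    using X by (auto simp: generator_eq_cls[OF R] generator_eq_cls[OF R'] h subset_iff)
  ultimately show ?thesis by (auto simp: mon_def)
qed

lemma infinite_presented_group:
  assumes R: "R \<subseteq> carrier (free_group X)" and "x \<in> X" "free_in R {x}"
  shows "infinite (carrier (presented_group X R))"
proof -
  let ?p = "\<lambda>m. replicate m (x, True)"
  have red: "reduced (?p m)" for m
    by (induction m) (auto simp: reduced_Cons inv_letter_def hd_replicate)
  have p: "?p m \<in> words_over {x}" for m by (auto simp: words_over_def)
  have "inj (\<lambda>m. cls X R (?p m))"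
  proof (rule injI)
    fix m m' assume "cls X R (?p m) = cls X R (?p m')"
    moreover have "?p m \<in> words_over X" using p assms(2) words_over_mono by blast
    ultimately have "eqv R (?p m) (?p m')" by (simp add: cls_eq_iff)
    then have "eqv {} (?p m) (?p m')" using free_in_eqv assms(3) p by blast
    then have "?p m = ?p m'" using red by (simp add: eqv_empty_iff reduce_reduced)
    then show "m = m'" by (metis length_replicate)
  qed
  moreover have "range (\<lambda>m. cls X R (?p m)) \<subseteq> carrier (presented_group X R)"
    using p assms(2) words_over_mono[of _ "{x}" X] by (auto simp: carrier_presented_group[OF R])
  ultimately show ?thesis using infinite_super finite_imageD infinite_UNIV_nat by blast
qed

section \<open>The linear and the cyclic chain\<close>

abbreviation ren :: "('a \<Rightarrow> 'b) \<Rightarrow> 'a word \<Rightarrow> 'b word" where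
  "ren f \<equiv> map (map_prod f id)"

lemma ren_ren: "ren g (ren f u) = ren (\<lambda>x. g (f x)) u"
  by (simp add: o_def prod.map_comp split_beta map_prod_def)

lemma ren_words_over: "ren f u \<in> words_over (f ` X)" if "u \<in> words_over X"
  using that by (induction u) auto

lemma ren_cong: "u \<in> words_over X \<Longrightarrow> (\<And>x. x \<in> X \<Longrightarrow> f x = g x) \<Longrightarrow> ren f u = ren g u"
  by (induction u) (auto simp: map_prod_def split_beta)

lemma ren_id: "u \<in> words_over X \<Longrightarrow> (\<And>x. x \<in> X \<Longrightarrow> f x = x) \<Longrightarrow> ren f u = u"
  by (induction u) (auto simp: map_prod_def split_beta)

lemma ren_image_words_over:
  assumes "u \<in> words_over (f ` X)"
  obtains v where "v \<in> words_over X" "u = ren f v"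
proof -
  have "\<exists>v \<in> words_over X. u = ren f v"
    using assms
  proof (induction u)
    case (Cons a u)
    then obtain v where "v \<in> words_over X" "u = ren f v" by fastforce
    moreover obtain x where "x \<in> X" "fst a = f x" using Cons.prems by auto
    ultimately show ?case by (intro bexI[of _ "(x, snd a) # v"]) (auto simp: prod_eq_iff)
  qed auto
  then show thesis using that by blast
qed

lemma involves_ren: "involves u x \<Longrightarrow> involves (ren f u) (f x)"
  by (force simp: involves_def)

lemma reduced_ren: "inj f \<Longrightarrow> reduced u \<Longrightarrow> reduced (ren f u)"
proof (induction u)
  case (Cons a u)
  then show ?case
    by (cases u) (auto simp: reduced_Cons inv_letter_def prod_eq_iff inj_eq)
qed simp

text \<open>Relations are pushed forward along \<open>g\<close>, found to be free there, and taken
  back by the one-sided inverse \<open>f\<close>.\<close>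

lemma free_in_ren:
  assumes "free_in (ren g ` R) (g ` Y)" "\<And>y. y \<in> Y \<Longrightarrow> f (g y) = y"
  shows "free_in R Y"
  unfolding free_in_def
proof (intro ballI impI)
  fix u assume u: "u \<in> words_over Y" "eqv R u []"
  then have "eqv {} (ren g u) []"
    using assms(1) ren_words_over eqv_rename[OF u(2), of g] by (fastforce simp: free_in_def)
  from eqv_rename[OF this, of f] show "eqv {} u []"
    using ren_id[OF u(1), of "\<lambda>x. f (g x)"] assms(2) by (simp only: ren_ren) simp
qed

lemma meets_in_ren:
  assumes "meets_in R Y C" "\<And>y. g (f y) = y"
  shows "meets_in (ren f ` R) (f ` Y) (f ` C)"
  unfolding meets_in_def
proof (intro ballI impI)
  have id: "ren g (ren f u) = u" for u using assms(2) by (simp only: ren_ren) (auto intro!: ren_id[of u UNIV] simp: words_over_def)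
  fix u c assume "u \<in> words_over (f ` Y)" "c \<in> words_over (f ` C)" and eq: "eqv (ren f ` R) u c"
  then obtain u' c' where u': "u' \<in> words_over Y" "u = ren f u'" "c' \<in> words_over C" "c = ren f c'"
    by (metis ren_image_words_over)
  have "ren g ` ren f ` R = R" by (simp only: image_image id) simp
  then have "eqv R u' c'" using eqv_rename[OF eq, of g] u' id by metis
  then obtain d where d: "d \<in> words_over (Y \<inter> C)" "eqv {} u' d"
    using meets_inD[OF assms(1)] u' by metis
  then have "ren f d \<in> words_over (f ` Y \<inter> f ` C)"
    using ren_words_over[of d "Y \<inter> C" f] words_over_mono image_Int_subset by metis
  then show "\<exists>d \<in> words_over (f ` Y \<inter> f ` C). eqv {} u d"
    using eqv_rename[OF d(2), of f] u' by auto
qed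

lemma mod_less_double: "x < n + n \<Longrightarrow> x mod n = (if x < n then x else x - n)" for n :: nat
  by (simp add: le_mod_geq)

lemma rotate_back:
  assumes "y < n" "a + b = n"
  shows "((y + a) mod n + b) mod n = (y :: nat)"
proof -
  have "((y + a) mod n + b) mod n = (y + (a + b)) mod n"
    by (simp only: mod_add_left_eq add.assoc)
  with assms show ?thesis by simp
qed

section \<open>Translates of a pure word\<close>

locale pure_word =
  fixes k t :: nat and w :: "nat word"
  assumes t: "0 < t" "t \<le> k" and w: "w \<in> words_over {0..k}" "cyclically_reduced w" "t_pure k t w"
begin

lemma involves_ends: "involves w 0" "involves w k"
  using w by (auto simp: t_pure_def)

lemma reduced_w: "reduced w" "reduced (w @ w)"
proof -
  have "w \<noteq> []" using involves_ends by (auto simp: involves_def)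
  then show "reduced w" "reduced (w @ w)"
    using w(2) by (auto simp: cyclically_reduced_def reduced_def successively_append_iff)
qed

lemma w_in_free_group: "w \<in> carrier (free_group {0..k})"
  using w reduced_w by (simp add: carrier_free_group)

text \<open>Not being exceptional gives \<open>d\<close> up to the relator. Both words lie over
  \<open>M\<close>, which is free, so they are freely equal; free reduction then restricts
  \<open>M\<close> to \<open>Y\<close>.\<close>

lemma meets_in_if_subset:
  assumes "magnus_subset {0..k} w M" "\<not> exceptional_intersection {0..k} w M C" "C \<subseteq> {0..k}" "Y \<subseteq> M"
  shows "meets_in {w} Y C"
  unfolding meets_in_def
proof (intro ballI impI)
  fix u c assume u: "u \<in> words_over Y" "c \<in> words_over C" "eqv {w} u c"
  have M: "M \<subseteq> {0..k}" using assms(1) by (simp add: magnus_subset_def)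
  have uM: "u \<in> words_over M" using u assms(4) words_over_mono by blast
  obtain d where d: "d \<in> words_over (M \<inter> C)" "eqv {w} u d"
    by (rule words_if_not_exceptional[OF w_in_free_group M assms(3,2) uM u(2,3)])
  obtain x where "x \<notin> M" "involves w x" using assms(1) by (auto simp: magnus_subset_def)
  then have "free_in {w} M"
    using freiheitssatz[OF reduced_w(2)] by (auto intro: free_in_mono)
  then have "eqv {} u d"
    using free_in_eqv uM d by (metis words_over_Int)
  then obtain d' where "d' \<in> words_over (Y \<inter> C)" "eqv {} u d'"
    using eqv_empty_words_over_Int[OF _ u(1)] d(1) words_over_Int by metis
  then show "\<exists>d \<in> words_over (Y \<inter> C). eqv {} u d" by blast
qed

text \<open>The letters of the \<open>j\<close>-th translate outside the middle block, in local
  numbering. If \<open>k \<le> j\<close>, letter 0 falls into the block; if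
  \<open>k + j < m\<close>, letter \<open>k\<close> does. Otherwise the block removes the letters
  from \<open>k - j\<close> to \<open>m - j - 1\<close>, at least \<open>t\<close> of them, which
  leads to \<open>X_{i,i+t-1}\<close> with \<open>i = k - j\<close>.\<close>

lemma meets_in_ends:
  assumes m: "k + t \<le> m" "j < m" and C: "C = {1..k} \<or> C = {0..<k}"
  shows "meets_in {w} {p \<in> {0..k}. p + j \<notin> {k..<m}} C"
proof -
  note magnus = t_pure_magnus_subsets[OF w(3) t]
  have pure: "\<not> exceptional_intersection {0..k} w {1..k} {0..<k}"
    "\<And>i. i \<in> {1..k - t} \<Longrightarrow> \<not> exceptional_intersection {0..k} w ({..<i} \<union> {i + t..k}) {1..k}"
    "\<And>i. i \<in> {1..k - t} \<Longrightarrow> \<not> exceptional_intersection {0..k} w ({..<i} \<union> {i + t..k}) {0..<k}"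
    using w(3) unfolding t_pure_def by blast+
  consider (right) "k \<le> j" | (left) "k + j < m" | (middle) "j < k" "m \<le> k + j" by linarith
  then obtain M where "magnus_subset {0..k} w M" "\<not> exceptional_intersection {0..k} w M {1..k}"
    "\<not> exceptional_intersection {0..k} w M {0..<k}" "{p \<in> {0..k}. p + j \<notin> {k..<m}} \<subseteq> M"
  proof cases
    case right
    with pure(1) magnus(1) m show ?thesis
      by (intro that[of "{1..k}"]) (auto simp: exceptional_intersection_def)
  next
    case left
    with pure(1) magnus(2) show ?thesis
      by (intro that[of "{0..<k}"]) (auto simp: exceptional_intersection_def Int_commute)
  next
    case middle
    then have i: "k - j \<in> {1..k - t}" using m t by auto
    show ?thesis
      using m middle by (intro that[OF magnus(3)[OF i] pure(2)[OF i] pure(3)[OF i]]) auto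
  qed
  with C show ?thesis by (intro meets_in_if_subset) auto
qed

definition shift :: "nat \<Rightarrow> nat word" where
  "shift j = ren (\<lambda>x. x + j) w"

lemma free_in_shift:
  assumes "involves w x"
  shows "free_in {shift j} (UNIV - {x + j})"
proof (rule freiheitssatz)
  have "reduced (ren (\<lambda>x. x + j) (w @ w))"
    by (rule reduced_ren[OF _ reduced_w(2)]) (simp add: inj_def)
  then show "reduced (shift j @ shift j)" by (simp add: shift_def)
  show "involves (shift j) (x + j)" unfolding shift_def by (rule involves_ren[OF assms])
qed

text \<open>The overlap of adjacent windows misses the first letter of the left relator and the last
  letter of the right one; \<open>w\<close> involves both ends, so the Freiheitssatz applies on
  either side.\<close>

sublocale chain "\<lambda>j. {j..j + k}" shift
proof
  fix i j :: nat
  show "shift j \<in> words_over {j..j + k}"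
    using ren_words_over[OF w(1), of "\<lambda>x. x + j"] by (simp add: shift_def add.commute)
  show "i \<le> j \<Longrightarrow> {i..i + k} \<inter> {Suc j..Suc j + k} \<subseteq> {j..j + k}" by auto
  show "free_in {shift j} ({j..j + k} \<inter> {Suc j..Suc j + k})"
    by (rule free_in_mono[OF free_in_shift[OF involves_ends(1)]]) auto
  show "free_in {shift (Suc j)} ({j..j + k} \<inter> {Suc j..Suc j + k})"
    by (rule free_in_mono[OF free_in_shift[OF involves_ends(2)]]) auto
qed

lemma meets_in_shift:
  assumes "k + t \<le> m" "j < m" "C = {1..k} \<or> C = {0..<k}"
  shows "meets_in {shift j} ((UNIV - {k..<m}) \<inter> {j..j + k}) ((\<lambda>x. x + j) ` C)"
proof -
  have "(\<lambda>x. x + j) ` {p \<in> {0..k}. p + j \<notin> {k..<m}} = (UNIV - {k..<m}) \<inter> {j..j + k}"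
  proof (intro equalityI subsetI)
    fix x assume "x \<in> (UNIV - {k..<m}) \<inter> {j..j + k}"
    then show "x \<in> (\<lambda>x. x + j) ` {p \<in> {0..k}. p + j \<notin> {k..<m}}"
      by (intro image_eqI[of _ _ "x - j"]) auto
  qed auto
  with meets_in_ren[OF meets_in_ends[OF assms], of "\<lambda>x. x - j" "\<lambda>x. x + j"] show ?thesis
    by (simp add: shift_def)
qed

text \<open>\<open>Z\<close> is the complement of the middle block \<open>{k..<m}\<close> of at
  least \<open>t\<close> letters. The \<open>m\<close> relators are numbered up to
  \<open>m - 1\<close>.\<close>

lemma free_in_linear:
  assumes m: "k + t \<le> m"
  shows "free_in (shift ` {..<m}) ({0..<k} \<union> {m..<m + k})"
proof -
  have "free_in (shift ` {..m - 1}) ((UNIV - {k..<m}) \<inter> initial (m - 1))"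
  proof (rule free_in_subchain)
    fix j assume "j \<le> m - 1"
    moreover have "{j..j + k} \<inter> {Suc j..Suc j + k} = (\<lambda>x. x + j) ` {1..k}" by auto
    ultimately show "meets_in {shift j} ((UNIV - {k..<m}) \<inter> {j..j + k}) ({j..j + k} \<inter> {Suc j..Suc j + k})"
      using meets_in_shift[OF m, of j "{1..k}"] m t by (auto simp: add.commute)
  next
    fix j assume "Suc j \<le> m - 1"
    moreover have "{j..j + k} \<inter> {Suc j..Suc j + k} = (\<lambda>x. x + Suc j) ` {0..<k}"
      by (simp only: image_add_atLeastLessThan') auto
    ultimately show "meets_in {shift (Suc j)} ((UNIV - {k..<m}) \<inter> {Suc j..Suc j + k})
        ({j..j + k} \<inter> {Suc j..Suc j + k})"
      using meets_in_shift[OF m, of "Suc j" "{0..<k}"] m t by auto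
  qed
  moreover have "{..m - 1} = {..<m}" using m t by auto
  moreover have "{0..<k} \<union> {m..<m + k} \<subseteq> (UNIV - {k..<m}) \<inter> initial (m - 1)"
  proof
    fix x assume x: "x \<in> {0..<k} \<union> {m..<m + k}"
    have "x \<in> {0..0 + k} \<or> x \<in> {m - 1..m - 1 + k}" using x by auto
    then have "x \<in> initial (m - 1)" unfolding initial_def by blast
    then show "x \<in> (UNIV - {k..<m}) \<inter> initial (m - 1)" using x m by auto
  qed
  ultimately show ?thesis using free_in_mono by metis
qed

definition rot :: "nat \<Rightarrow> nat \<Rightarrow> nat word" where
  "rot n j = ren (\<lambda>x. (x + j) mod n) w"

lemma theta_funpow:
  assumes "k < n"
  shows "(theta n ^^ i) w = rot n i"
proof (induction i)
  case 0
  show ?case using assms ren_id[OF w(1), of "\<lambda>x. x mod n"] by (simp add: rot_def)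
next
  case (Suc i)
  have "theta n (rot n i) = ren (\<lambda>x. (x + 1) mod n) (rot n i)"
    by (simp add: theta_def map_prod_def id_def)
  then show ?case using Suc by (simp add: rot_def ren_ren mod_Suc_eq del: map_map)
qed

lemma rot_eq_shift: "j + k < n \<Longrightarrow> rot n j = shift j"
  unfolding rot_def shift_def by (rule ren_cong[OF w(1)]) auto

lemma cyclic_relators_eq: "k < n \<Longrightarrow> cyclic_relators n w = rot n ` {..<n}"
  by (auto simp: cyclic_relators_def theta_funpow)

lemma ren_rot: "ren (\<lambda>x. (x + i) mod n) (rot n j) = rot n ((j + i) mod n)"
  unfolding rot_def ren_ren
  by (rule ren_cong[OF w(1)]) (simp add: mod_simps add.assoc)

text \<open>The first arc has exactly \<open>k + t\<close> translates and does not wrap around; the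
  second has the other \<open>n - m\<close>, at least \<open>k + t\<close> again. Each of the two
  cuts leaves \<open>k\<close> shared letters, \<open>{0..<k}\<close> and
  \<open>{m..<m + k}\<close>.\<close>

lemma eqv_cyclic_imp_linear:
  assumes n: "2 * k + 2 * t \<le> n" and u: "u \<in> words_over {0..k}" "eqv (rot n ` {..<n}) u []"
  shows "eqv {w} u []"
proof -
  define m where "m = k + t"
  define m' where "m' = n - m"
  have m: "k + t \<le> m" "k + t \<le> m'" "m + m' = n" "m + k \<le> n" "m' + k \<le> n"
    using n by (auto simp: m_def m'_def)
  let ?X1 = "{0..<m + k}" and ?X2 = "{m..<n} \<union> {0..<k}"
  let ?R1 = "shift ` {..<m}" and ?R2 = "rot n ` {m..<n}"
  have Int: "?X1 \<inter> ?X2 = {0..<k} \<union> {m..<m + k}" using m by auto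
  have "shift j \<in> words_over ?X1" if "j < m" for j
    using that by (intro words_over_mono[OF relator_words]) auto
  then have R1: "?R1 \<subseteq> words_over ?X1" by blast
  have "rot n j \<in> words_over ?X2" if "m \<le> j" "j < n" for j
  proof -
    have "(x + j) mod n \<in> ?X2" if "x \<in> {0..k}" for x
      using that \<open>m \<le> j\<close> \<open>j < n\<close> m t by (auto simp: mod_less_double)
    then have "(\<lambda>x. (x + j) mod n) ` {0..k} \<subseteq> ?X2" by blast
    then show ?thesis
      unfolding rot_def by (rule words_over_mono[OF ren_words_over[OF w(1)]])
  qed
  then have R2: "?R2 \<subseteq> words_over ?X2" by auto
  \<comment> \<open>Rotation by \<open>m'\<close>, that is by \<open>- m\<close> modulo
    \<open>n\<close>, turns the second arc into the linear chain of length \<open>m'\<close> and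
    carries the two shared blocks to its ends.\<close>
  have "free_in ?R2 (?X1 \<inter> ?X2)"
  proof (rule free_in_ren[where g = "\<lambda>x. (x + m') mod n" and f = "\<lambda>x. (x + m) mod n"])
    have "ren (\<lambda>x. (x + m') mod n) (rot n j) \<in> shift ` {..<m'}" if "m \<le> j" "j < n" for j
    proof -
      have "(j + m') mod n = j - m"
        using that m by (simp add: mod_less_double)
      moreover have "rot n (j - m) = shift (j - m)"
        using that m by (intro rot_eq_shift) auto
      ultimately show ?thesis using that m unfolding ren_rot by auto
    qed
    then have "ren (\<lambda>x. (x + m') mod n) ` ?R2 \<subseteq> shift ` {..<m'}" by auto
    moreover have "(\<lambda>x. (x + m') mod n) ` (?X1 \<inter> ?X2) \<subseteq> {0..<k} \<union> {m'..<m' + k}"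
      unfolding Int using m by (auto simp: mod_less_double)
    ultimately show "free_in (ren (\<lambda>x. (x + m') mod n) ` ?R2) ((\<lambda>x. (x + m') mod n) ` (?X1 \<inter> ?X2))"
      using free_in_mono free_in_antimono free_in_linear[OF m(2)] by metis
  next
    fix y assume "y \<in> ?X1 \<inter> ?X2"
    then have "y < n" using m by auto
    then show "((y + m') mod n + m) mod n = y"
      using m by (intro rotate_back) auto
  qed
  with R1 R2 free_in_linear[OF m(1)] interpret
    amalgam "\<lambda>b. if b then ?X1 else ?X2" "\<lambda>b. if b then ?R1 else ?R2"
    by (intro amalgam_over_free) (auto simp: Int)
  have "{..<n} = {..<m} \<union> {m..<n}" using m by auto
  moreover have "rot n j = shift j" if "j < m" for j
    using that m by (intro rot_eq_shift) auto
  ultimately have "rot n ` {..<n} = ?R1 \<union> ?R2" by (auto simp: image_Un)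
  moreover have "{0..k} \<subseteq> ?X1" using m t by auto
  then have "u \<in> words_over ?X1" using u(1) words_over_mono by blast
  ultimately have "eqv ?R1 u []" using factor_embeds[of u True] u(2) by simp
  moreover have "{..<m} = {..m - 1}" using m t by auto
  moreover have "u \<in> words_over {0..0 + k}" using u(1) by simp
  ultimately have "eqv {shift 0} u []" using piece_embeds[of 0 "m - 1" u] by simp
  moreover have "shift 0 = w"
    unfolding shift_def by (rule ren_id[OF w(1)]) simp
  ultimately show ?thesis by simp
qed

text \<open>The rotation taking \<open>i\<close> to 0 maps the set of all relators into itself and
  the window into \<open>{0..k}\<close>.\<close>

lemma eqv_cyclic_imp_window:
  assumes n: "2 * k + 2 * t \<le> n" "i < n"
    and u: "u \<in> words_over (cyclic_window n k i)" "eqv (rot n ` {..<n}) u []"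
  shows "eqv {rot n i} u []"
proof -
  let ?g = "\<lambda>x. (x + (n - i)) mod n" and ?f = "\<lambda>x. (x + i) mod n"
  have kn: "k < n" using n t by auto
  have "?g ` cyclic_window n k i \<subseteq> {0..k}"
  proof
    fix y assume "y \<in> ?g ` cyclic_window n k i"
    then obtain j where "j \<le> k" "y = ((j + i) mod n + (n - i)) mod n"
      by (auto simp: cyclic_window_def add.commute)
    moreover have "((j + i) mod n + (n - i)) mod n = j"
      using n kn \<open>j \<le> k\<close> by (intro rotate_back) auto
    ultimately show "y \<in> {0..k}" by simp
  qed
  then have "ren ?g u \<in> words_over {0..k}" using ren_words_over[OF u(1)] words_over_mono by blast
  moreover have "ren ?g (rot n j) \<in> rot n ` {..<n}" for j
    using n unfolding ren_rot by simp
  then have "ren ?g ` rot n ` {..<n} \<subseteq> rot n ` {..<n}" by blast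
  then have "eqv (rot n ` {..<n}) (ren ?g u) []"
    using eqv_rename[OF u(2), of ?g] eqv_mono by fastforce
  ultimately have "eqv {w} (ren ?g u) []" using eqv_cyclic_imp_linear n by blast
  from eqv_rename[OF this, of ?f] have "eqv {rot n i} (ren (\<lambda>x. ?f (?g x)) u) []"
    by (simp only: ren_ren) (simp add: rot_def)
  moreover have "ren (\<lambda>x. ?f (?g x)) u = u"
    using n by (intro ren_id[OF u(1)] rotate_back) (auto simp: cyclic_window_def)
  ultimately show ?thesis by simp
qed

lemma rot_words: "rot n i \<in> words_over (cyclic_window n k i)"
proof -
  have "(\<lambda>x. (x + i) mod n) ` {0..k} \<subseteq> cyclic_window n k i"
    by (auto simp: cyclic_window_def add.commute)
  then show ?thesis
    unfolding rot_def using ren_words_over[OF w(1)] words_over_mono by blast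
qed

lemma rot_in_free_group:
  assumes "k < n"
  shows "rot n i \<in> carrier (free_group {0..<n})"
proof -
  have "w \<in> carrier (free_group {0..<n})"
    using w(1) reduced_w assms by (auto simp: carrier_free_group intro: words_over_mono)
  then have "(theta n ^^ i) w \<in> carrier (free_group {0..<n})"
    by (induction i) (auto intro: theta_in_free_group)
  then show ?thesis by (simp add: theta_funpow assms)
qed

end

theorem theorem1p3:
  fixes k t n :: nat and w :: "nat word"
  assumes "0 < t" and "t \<le> k"
    and "w \<in> words_over {0..k}" and "cyclically_reduced w" and "t_pure k t w"
    and "n \<ge> 2 * k + 2 * t"
  shows "(\<forall>i < n. \<exists>h \<in> mon (presented_group (cyclic_window n k i) {(theta n ^^ i) w})
                          (cyclically_presented_group n w).
            \<forall>x \<in> cyclic_window n k i.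
              h (generator (cyclic_window n k i) {(theta n ^^ i) w} x)
                = generator {0..<n} (cyclic_relators n w) x)
    \<and> infinite (carrier (cyclically_presented_group n w))"
proof -
  interpret pure_word k t w using assms by unfold_locales
  have kn: "k < n" "0 < n" using assms by auto
  have R: "rot n ` {..<n} \<subseteq> carrier (free_group {0..<n})" using rot_in_free_group kn by blast
  have "\<exists>h \<in> mon (presented_group (cyclic_window n k i) {rot n i}) (presented_group {0..<n} (rot n ` {..<n})).
      \<forall>x \<in> cyclic_window n k i. h (generator (cyclic_window n k i) {rot n i} x) = generator {0..<n} (rot n ` {..<n}) x"
    if "i < n" for i
  proof (rule presented_group_mon[OF _ _ R])
    show "cyclic_window n k i \<subseteq> {0..<n}" using kn by (auto simp: cyclic_window_def)
    show "{rot n i} \<subseteq> carrier (free_group (cyclic_window n k i))"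
      using rot_words rot_in_free_group[OF kn(1)] by (auto simp: carrier_free_group)
  qed (use that eqv_cyclic_imp_window assms(6) in auto)
  moreover have "free_in (rot n ` {..<n}) {0}"
  proof -
    \<comment> \<open>\<open>w\<close> involves the letter \<open>k\<close>, which is not 0, so
      letter 0 has infinite order in the one-relator group; the embedding carries this over.\<close>
    have "free_in {w} {0}"
      using freiheitssatz[OF reduced_w(2) involves_ends(2)] t by (auto intro: free_in_mono)
    then show ?thesis
      using eqv_cyclic_imp_linear[OF assms(6)] words_over_mono[of _ "{0}" "{0..k}"]
      unfolding free_in_def by auto
  qed
  then have "infinite (carrier (presented_group {0..<n} (rot n ` {..<n})))"
    using infinite_presented_group[OF R, of 0] kn by simp
  ultimately show ?thesis
    using kn by (simp add: cyclically_presented_group_def cyclic_relators_eq theta_funpow)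
qed

end
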